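(* Let $p$ be a prime with $p\equiv 3 \pmod 8$. Then there exists a finite solvable group $G$ with $\mathrm{dl}(G)=4$, Fitting height $2$, and $\mathrm{cd}(G)=\{1,2,8,2p^2\}$.
   Context: $\mathrm{cd}(G)$ is the set of degrees of irreducible complex characters of $G$, and $\mathrm{dl}(G)$ is the derived length of $G$. *)

theory Defs
  imports "HOL-Algebra.Algebra" "Jordan_Normal_Form.Matrix"
begin

definition derived_length :: "('a, 'b) monoid_scheme \<Rightarrow> nat" where
  "derived_length G = (LEAST n. ((derived G) ^^ n) (carrier G) = {\<one>\<^bsub>G\<^esub>})"

definition commutator_subgroup :: "('a, 'b) monoid_scheme \<Rightarrow> 'a set \<Rightarrow> 'a set \<Rightarrow> 'a set" where
  "commutator_subgroup G A B =
     generate G (\<Union>a \<in> A. \<Union>b \<in> B. {a \<otimes>\<^bsub>G\<^esub> b \<otimes>\<^bsub>G\<^esub> inv\<^bsub>G\<^esub> a \<otimes>\<^bsub>G\<^esub> inv\<^bsub>G\<^esub> b})"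

text \<open>Lower central series: gamma_1 = G (index 0 here), gamma_{i+1} = [gamma_i, G].\<close>
primrec lower_central :: "('a, 'b) monoid_scheme \<Rightarrow> nat \<Rightarrow> 'a set" where
  "lower_central G 0 = carrier G"
| "lower_central G (Suc n) = commutator_subgroup G (lower_central G n) (carrier G)"

definition nilpotent_group :: "('a, 'b) monoid_scheme \<Rightarrow> bool" where
  "nilpotent_group G \<longleftrightarrow> group G \<and> (\<exists>n. lower_central G n = {\<one>\<^bsub>G\<^esub>})"

definition fitting_height :: "('a, 'b) monoid_scheme \<Rightarrow> nat" where
  "fitting_height G = (LEAST h. \<exists>N :: nat \<Rightarrow> 'a set.
      N 0 = {\<one>\<^bsub>G\<^esub>} \<and> N h = carrier G \<and>
      (\<forall>i \<le> h. N i \<lhd> G) \<and>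
      (\<forall>i < h. N i \<subseteq> N (Suc i) \<and>
               nilpotent_group ((G\<lparr>carrier := N (Suc i)\<rparr>) Mod (N i))))"

definition matrix_rep :: "('a, 'b) monoid_scheme \<Rightarrow> nat \<Rightarrow> ('a \<Rightarrow> complex mat) \<Rightarrow> bool" where
  "matrix_rep G n \<rho> \<longleftrightarrow>
     (\<forall>g \<in> carrier G. \<rho> g \<in> carrier_mat n n) \<and>
     \<rho> \<one>\<^bsub>G\<^esub> = 1\<^sub>m n \<and>
     (\<forall>g \<in> carrier G. \<forall>h \<in> carrier G. \<rho> (g \<otimes>\<^bsub>G\<^esub> h) = \<rho> g * \<rho> h)"

definition invariant_subspace :: "('a, 'b) monoid_scheme \<Rightarrow> nat \<Rightarrow> ('a \<Rightarrow> complex mat) \<Rightarrow> complex vec set \<Rightarrow> bool" where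
  "invariant_subspace G n \<rho> W \<longleftrightarrow>
     W \<subseteq> carrier_vec n \<and> 0\<^sub>v n \<in> W \<and>
     (\<forall>v \<in> W. \<forall>w \<in> W. v + w \<in> W) \<and>
     (\<forall>c. \<forall>v \<in> W. c \<cdot>\<^sub>v v \<in> W) \<and>
     (\<forall>g \<in> carrier G. \<forall>v \<in> W. \<rho> g *\<^sub>v v \<in> W)"

definition irreducible_rep :: "('a, 'b) monoid_scheme \<Rightarrow> nat \<Rightarrow> ('a \<Rightarrow> complex mat) \<Rightarrow> bool" where
  "irreducible_rep G n \<rho> \<longleftrightarrow> 0 < n \<and> matrix_rep G n \<rho> \<and>
     (\<forall>W. invariant_subspace G n \<rho> W \<longrightarrow> W = {0\<^sub>v n} \<or> W = carrier_vec n)"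

text \<open>cd(G): degrees of the irreducible complex characters = dimensions of the
  irreducible complex representations.\<close>
definition char_degrees :: "('a, 'b) monoid_scheme \<Rightarrow> nat set" where
  "char_degrees G = {n. \<exists>\<rho>. irreducible_rep G n \<rho>}"

end

theory Submission
  imports Defs "HOL-Library.Countable" "HOL-Number_Theory.Cong"
begin

text \<open>
  The group is \<open>P \<rtimes> Q\<^sub>8\<close>, where \<open>P\<close> is the Heisenberg group of order \<open>p\<^sup>5\<close> on \<open>W \<oplus> W\<close> and \<open>W = \<F>\<^sub>p\<^sup>2\<close> is the
  faithful \<open>Q\<^sub>8\<close>-module. The form on \<open>W \<oplus> W\<close> comes from the dot product on \<open>W\<close>, which \<open>Q\<^sub>8\<close> preserves up to
  a sign character \<open>\<chi>\<close> with kernel \<open>C\<^sub>4\<close>. The characters of \<open>Q\<^sub>8\<close> have degrees 1 and 2; as \<open>Q\<^sub>8\<close> acts freely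
  on the nontrivial linear characters of \<open>P\<close>, these contribute the degree \<open>|Q\<^sub>8| = 8\<close>; and a nontrivial character
  of the centre of \<open>P\<close> has stabiliser \<open>P C\<^sub>4\<close>, which contributes \<open>2 p\<^sup>2\<close>. The derived series is
  \<open>G > P Z(Q\<^sub>8) > P > Z(P) > 1\<close>.

  All irreducible representations of \<open>G\<close> are induced from linear characters: if \<open>\<mu>\<close> is a linear character
  of \<open>T\<close>, and the stabiliser of its restriction to some \<open>N \<lhd> G\<close> with \<open>N \<subseteq> T\<close> lies in \<open>T\<close>, then
  inducing \<open>\<mu>\<close> gives an irreducible representation, and every irreducible representation
  in which \<open>T\<close> has an eigenvector of weight \<open>\<mu>\<close> has degree \<open>|G : T|\<close>.\<close>

section \<open>Linear algebra over the complex numbers\<close>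

text \<open>The sign \<open>chi\<close> is what the matrices M(x) are chosen for. For p congruent to
  3 modulo 4 the field has no square root of -1, so neither j nor k can be diagonal; a solution of
  a^2 + b^2 = -1 instead gives symmetric matrices of square -1, while i stays a rotation. Hence
  M(x)^T M(x) is 1 on C4 and -1 outside, and x acts on the centre of P by this sign. A form fixed by
  all of Q8 would leave central characters fixed, and the degree p^2 would occur.

  To avoid inducing from representations of degree p^2, nontrivial central characters are treated
  with the abelian normal subgroup N of all (v, z), where u = 0. The weight of N that depends on z
  only has the stabiliser T = N C4, of index 2 p^2, and it extends to a linear character of T.

  Excluding further degrees rests on eigenvectors alone: if a normal subgroup K fixes a nonzero
  vector and T commutes modulo K, some nonzero vector fixed by K is an eigenvector of T. Either its
  weight is nontrivial at the decisive place, which settles the degree, or the vector is fixed by a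
  larger normal subgroup and the descent goes on.\<close>

definition lin_comb :: "nat \<Rightarrow> 'i set \<Rightarrow> ('i \<Rightarrow> complex) \<Rightarrow> ('i \<Rightarrow> complex vec) \<Rightarrow> complex vec" where
  "lin_comb n I x e = vec n (\<lambda>r. \<Sum>i\<in>I. x i * e i $ r)"

definition vsubspace :: "nat \<Rightarrow> complex vec set \<Rightarrow> bool" where
  "vsubspace n W \<longleftrightarrow> W \<subseteq> carrier_vec n \<and> 0\<^sub>v n \<in> W \<and>
     (\<forall>v \<in> W. \<forall>w \<in> W. v + w \<in> W) \<and> (\<forall>c. \<forall>v \<in> W. c \<cdot>\<^sub>v v \<in> W)"

lemma lin_comb_carrier [simp]: "lin_comb n I x e \<in> carrier_vec n"
  by (simp add: lin_comb_def)

lemma lin_comb_empty: "lin_comb n {} x e = 0\<^sub>v n"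
  by (auto simp: lin_comb_def)

lemma lin_comb_insert:
  assumes "finite I" "i \<notin> I" "e i \<in> carrier_vec n"
  shows "lin_comb n (insert i I) x e = x i \<cdot>\<^sub>v e i + lin_comb n I x e"
  using assms by (auto simp: lin_comb_def)

lemma lin_comb_cong:
  "(\<And>i. i \<in> I \<Longrightarrow> x i = y i) \<Longrightarrow> (\<And>i. i \<in> I \<Longrightarrow> e i = f i) \<Longrightarrow> lin_comb n I x e = lin_comb n I y f"
  unfolding lin_comb_def by (intro arg_cong[of _ _ "vec n"] ext sum.cong) auto

lemma lin_comb_smult_vec:
  assumes "\<And>i. i \<in> I \<Longrightarrow> e i \<in> carrier_vec n"
  shows "lin_comb n I x (\<lambda>i. c i \<cdot>\<^sub>v e i) = lin_comb n I (\<lambda>i. x i * c i) e"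
proof -
  have "dim_vec (e i) = n" if "i \<in> I" for i using assms that by fastforce
  thus ?thesis unfolding lin_comb_def by (intro eq_vecI) (auto intro!: sum.cong)
qed

lemma lin_comb_add: "lin_comb n I x e + lin_comb n I y e = lin_comb n I (\<lambda>i. x i + y i) e"
  by (auto simp: lin_comb_def sum.distrib ring_distribs)

lemma lin_comb_smult: "c \<cdot>\<^sub>v lin_comb n I x e = lin_comb n I (\<lambda>i. c * x i) e"
  by (auto simp: lin_comb_def sum_distrib_left mult.assoc)

lemma lin_comb_in_subspace:
  assumes "vsubspace n W" "finite I" "\<And>i. i \<in> I \<Longrightarrow> e i \<in> W"
  shows "lin_comb n I x e \<in> W"
  using assms(2,3)
proof (induction I)
  case empty
  then show ?case using assms(1) by (simp add: lin_comb_empty vsubspace_def)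
next
  case (insert i I)
  moreover have "e i \<in> carrier_vec n" using insert.prems assms(1) by (auto simp: vsubspace_def)
  ultimately show ?case using assms(1) by (simp add: lin_comb_insert vsubspace_def)
qed

lemma mult_mat_vec_lin_comb:
  assumes A: "A \<in> carrier_mat n n" and e: "\<And>i. i \<in> I \<Longrightarrow> e i \<in> carrier_vec n"
  shows "A *\<^sub>v lin_comb n I x e = lin_comb n I x (\<lambda>i. A *\<^sub>v e i)"
proof (rule eq_vecI)
  fix r assume "r < dim_vec (lin_comb n I x (\<lambda>i. A *\<^sub>v e i))"
  hence r: "r < n" by (simp add: lin_comb_def)
  have "(A *\<^sub>v lin_comb n I x e) $ r = (\<Sum>c<n. A $$ (r,c) * (\<Sum>i\<in>I. x i * e i $ c))"
    using A r by (simp add: lin_comb_def scalar_prod_def row_def lessThan_atLeast0)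
  also have "\<dots> = (\<Sum>i\<in>I. x i * (\<Sum>c<n. A $$ (r,c) * e i $ c))"
    by (simp add: sum_distrib_left sum.swap[of _ I] mult_ac)
  also have "\<dots> = (\<Sum>i\<in>I. x i * (A *\<^sub>v e i) $ r)"
  proof (intro sum.cong refl)
    fix i assume "i \<in> I"
    hence "dim_vec (e i) = n" using e by fastforce
    thus "x i * (\<Sum>c<n. A $$ (r,c) * e i $ c) = x i * (A *\<^sub>v e i) $ r"
      using A r by (simp add: scalar_prod_def row_def lessThan_atLeast0)
  qed
  finally show "(A *\<^sub>v lin_comb n I x e) $ r = lin_comb n I x (\<lambda>i. A *\<^sub>v e i) $ r"
    using r by (simp add: lin_comb_def)
qed (use A in \<open>auto simp: lin_comb_def\<close>)

lemma unit_vec_lin_comb: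
  assumes "w \<in> carrier_vec n"
  shows "w = lin_comb n {..<n} (\<lambda>i. w $ i) (unit_vec n)"
  by (rule eq_vecI) (use assms in \<open>auto simp: lin_comb_def unit_vec_def if_distrib[of "\<lambda>x. _ * x"] cong: if_cong\<close>)

text \<open>Compare the traces of \<open>B C = 1\<close> and \<open>C B = 1\<close>.\<close>

lemma basis_card:
  assumes e: "\<And>i. i < m \<Longrightarrow> e i \<in> carrier_vec n"
    and span: "\<And>w. w \<in> carrier_vec n \<Longrightarrow> \<exists>x. w = lin_comb n {..<m} x e"
    and indep: "\<And>x i. lin_comb n {..<m} x e = 0\<^sub>v n \<Longrightarrow> i < m \<Longrightarrow> x i = 0"
  shows "n = m"
proof -
  have "\<exists>x. unit_vec n k = lin_comb n {..<m} x e" for k by (rule span) simp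
  then obtain c where c: "\<And>k. unit_vec n k = lin_comb n {..<m} (c k) e" by metis
  have BC: "(\<Sum>i<m. c k i * e i $ r) = (if r = k then 1 else 0)" if "r < n" for r k
  proof -
    have "unit_vec n k $ r = lin_comb n {..<m} (c k) e $ r" using c by simp
    thus ?thesis using that by (simp add: lin_comb_def unit_vec_def)
  qed
  \<comment> \<open>Expanding \<open>e j\<close> in unit vectors and these again in \<open>e\<close>
    yields a second expression of \<open>e j\<close>; \<open>y\<close> is the coefficient
    difference, so independence makes it zero.\<close>
  have CB: "(\<Sum>k<n. e j $ k * c k i) = (if i = j then 1 else 0)" if "i < m" "j < m" for i j
  proof -
    define y where "y = (\<lambda>i. (\<Sum>k<n. e j $ k * c k i) - (if i = j then 1 else 0))"
    have "lin_comb n {..<m} y e = 0\<^sub>v n"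
    proof (rule eq_vecI)
      fix r assume "r < dim_vec (0\<^sub>v n :: complex vec)"
      hence r: "r < n" by simp
      have "(\<Sum>i<m. y i * e i $ r) = (\<Sum>i<m. (\<Sum>k<n. e j $ k * c k i) * e i $ r) - (\<Sum>i<m. (if i = j then 1 else 0) * e i $ r)"
        by (simp add: y_def left_diff_distrib sum_subtractf)
      also have "(\<Sum>i<m. (\<Sum>k<n. e j $ k * c k i) * e i $ r) = (\<Sum>k<n. e j $ k * (\<Sum>i<m. c k i * e i $ r))"
        by (simp add: sum_distrib_left sum_distrib_right sum.swap[of _ "{..<n}"] mult_ac)
      also have "\<dots> = (\<Sum>k<n. e j $ k * (if r = k then 1 else 0))" using BC r by simp
      also have "\<dots> = e j $ r" using r by (simp add: if_distrib[of "\<lambda>x. _ * x"] cong: if_cong)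
      also have "(\<Sum>i<m. (if i = j then 1 else 0) * e i $ r) = e j $ r"
        using that by (simp add: if_distrib[of "\<lambda>x. x * _"] cong: if_cong)
      finally show "lin_comb n {..<m} y e $ r = 0\<^sub>v n $ r" using r by (simp add: lin_comb_def)
    qed (simp add: lin_comb_def)
    from indep[OF this that(1)] show ?thesis by (simp add: y_def)
  qed
  have "of_nat n = (\<Sum>k<n. \<Sum>i<m. c k i * e i $ k)" using BC by simp
  also have "\<dots> = (\<Sum>i<m. \<Sum>k<n. e i $ k * c k i)" by (subst sum.swap) (simp add: mult_ac)
  also have "\<dots> = (of_nat m :: complex)" using CB by simp
  finally show "n = m" by simp
qed

text \<open>Induction on \<open>I\<close>: for \<open>y\<close> separating \<open>i\<close> from
  \<open>j\<close>, the operator \<open>\<rho> y\<close> minus \<open>l j y\<close> kills the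
  \<open>j\<close>-th term and multiplies the \<open>i\<close>-th by a nonzero factor. So all
  components but the \<open>j\<close>-th lie in \<open>W\<close>, and subtracting them leaves the
  \<open>j\<close>-th. With \<open>W\<close> zero this is linear independence of weight vectors;
  with \<open>W\<close> invariant it gives irreducibility of induced representations.\<close>

lemma weight_component_in_subspace:
  assumes W: "vsubspace n W" and I: "finite I"
    and \<rho>: "\<And>y. y \<in> N \<Longrightarrow> \<rho> y \<in> carrier_mat n n"
    and inv: "\<And>y v. y \<in> N \<Longrightarrow> v \<in> W \<Longrightarrow> \<rho> y *\<^sub>v v \<in> W"
    and e: "\<And>i. i \<in> I \<Longrightarrow> e i \<in> carrier_vec n"
    and weight: "\<And>i y. i \<in> I \<Longrightarrow> y \<in> N \<Longrightarrow> \<rho> y *\<^sub>v e i = l i y \<cdot>\<^sub>v e i"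
    and sep: "\<And>i j. i \<in> I \<Longrightarrow> j \<in> I \<Longrightarrow> i \<noteq> j \<Longrightarrow> \<exists>y\<in>N. l i y \<noteq> l j y"
    and mem: "lin_comb n I x e \<in> W" and k: "k \<in> I"
  shows "x k \<cdot>\<^sub>v e k \<in> W"
  using I e weight sep mem k
proof (induction I arbitrary: x k)
  case (insert j I)
  have car: "e i \<in> carrier_vec n" if "i \<in> insert j I" for i using insert.prems(1) that .
  have part: "x i \<cdot>\<^sub>v e i \<in> W" if i: "i \<in> I" for i
  proof -
    from insert i obtain y where y: "y \<in> N" "l i y \<noteq> l j y" by (metis insertCI)
    have "\<rho> y *\<^sub>v lin_comb n (insert j I) x e + (- l j y) \<cdot>\<^sub>v lin_comb n (insert j I) x e
        = lin_comb n (insert j I) (\<lambda>i. x i * l i y) e + (- l j y) \<cdot>\<^sub>v lin_comb n (insert j I) x e"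
      using mult_mat_vec_lin_comb[OF \<rho>[OF y(1)], of "insert j I" e x] car
        lin_comb_cong[of "insert j I" x x "\<lambda>i. \<rho> y *\<^sub>v e i" "\<lambda>i. l i y \<cdot>\<^sub>v e i"]
        lin_comb_smult_vec[of "insert j I" e n x "\<lambda>i. l i y"] insert.prems(2)[OF _ y(1)] by simp
    also have "\<dots> = lin_comb n (insert j I) (\<lambda>i. (l i y - l j y) * x i) e"
      unfolding lin_comb_smult lin_comb_add by (intro lin_comb_cong) (auto simp: algebra_simps)
    also have "\<dots> = lin_comb n I (\<lambda>i. (l i y - l j y) * x i) e"
      using car[of j] insert.hyps by (auto simp: lin_comb_insert) (auto simp: lin_comb_def)
    finally have "lin_comb n I (\<lambda>i. (l i y - l j y) * x i) e \<in> W"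
      using inv[OF y(1) insert.prems(4)] insert.prems(4) W unfolding vsubspace_def by metis
    from insert.IH[OF _ _ _ this i] insert.prems
    have "((l i y - l j y) * x i) \<cdot>\<^sub>v e i \<in> W" by blast
    hence "inverse (l i y - l j y) \<cdot>\<^sub>v (((l i y - l j y) * x i) \<cdot>\<^sub>v e i) \<in> W"
      using W by (simp add: vsubspace_def)
    thus ?thesis using y by (simp add: smult_smult_assoc mult.assoc[symmetric])
  qed
  show ?case
  proof (cases "k = j")
    case True
    have "lin_comb n I (\<lambda>i. - 1) (\<lambda>i. x i \<cdot>\<^sub>v e i) \<in> W"
      by (rule lin_comb_in_subspace[OF W insert.hyps(1)]) (rule part)
    hence "lin_comb n I (\<lambda>i. - x i) e \<in> W" using car by (simp add: lin_comb_smult_vec)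
    hence "lin_comb n (insert j I) x e + lin_comb n I (\<lambda>i. - x i) e \<in> W"
      using insert.prems(4) W by (simp add: vsubspace_def)
    also have "lin_comb n (insert j I) x e + lin_comb n I (\<lambda>i. - x i) e = x j \<cdot>\<^sub>v e j"
      using car[of j] insert.hyps by (auto simp: lin_comb_insert) (auto simp: lin_comb_def sum_negf)
    finally show ?thesis using True by simp
  qed (use part insert.prems in auto)
qed simp

text \<open>A discrete Fourier transform: for every m-th root of unity \<open>z k\<close> the vector
  \<open>u k\<close> is zero or an eigenvector with eigenvalue \<open>inverse (z k)\<close>, and the
  sum of all \<open>u k\<close> is m times \<open>w\<close>, so not all of them vanish.\<close>

lemma finite_order_eigenvector:
  fixes A :: "complex mat"
  assumes A: "A \<in> carrier_mat n n" and W: "vsubspace n W" and m: "m > 0"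
    and inv: "\<And>v. v \<in> W \<Longrightarrow> A *\<^sub>v v \<in> W"
    and per: "\<And>v. v \<in> W \<Longrightarrow> ((*\<^sub>v) A ^^ m) v = v"
    and w: "w \<in> W" "w \<noteq> 0\<^sub>v n"
  shows "\<exists>v c. v \<in> W \<and> v \<noteq> 0\<^sub>v n \<and> A *\<^sub>v v = c \<cdot>\<^sub>v v"
proof (rule ccontr)
  assume contra: "\<not> ?thesis"
  define f where "f l = ((*\<^sub>v) A ^^ l) w" for l
  have fW: "f l \<in> W" for l by (induction l) (use w inv in \<open>auto simp: f_def\<close>)
  hence fc: "f l \<in> carrier_vec n" for l using W by (auto simp: vsubspace_def)
  define z where "z k = cis (2 * pi * real k / real m)" for k
  have bij: "bij_betw z {..<m} {z. z ^ m = 1}"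
    using bij_betw_roots_unity[OF m] by (simp add: z_def[abs_def])
  define u where "u k = lin_comb n {..<m} (\<lambda>l. z k ^ l) f" for k
  have u0: "u k = 0\<^sub>v n" if k: "k < m" for k
  proof (rule ccontr)
    assume nz: "u k \<noteq> 0\<^sub>v n"
    have zk: "z k ^ m = 1" using bij k by (auto simp: bij_betw_def)
    hence z0: "z k \<noteq> 0" using m by (auto simp: power_0_left)
    have "A *\<^sub>v u k = lin_comb n {..<m} (\<lambda>l. z k ^ l) (\<lambda>l. f (Suc l))"
      unfolding u_def using fc by (subst mult_mat_vec_lin_comb[OF A]) (auto simp: f_def)
    also have "\<dots> = inverse (z k) \<cdot>\<^sub>v u k"
    proof (rule eq_vecI)
      fix r assume "r < dim_vec (inverse (z k) \<cdot>\<^sub>v u k)"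
      hence r: "r < n" by (simp add: u_def lin_comb_def)
      \<comment> \<open>Multiplication by \<open>z k\<close> shifts the index by one; the boundary
        terms at 0 and m agree because both the powers of \<open>z k\<close> and the iterates on
        \<open>w\<close> have period m.\<close>
      have "z k * (\<Sum>l<m. z k ^ l * f (Suc l) $ r) = (\<Sum>l<m. z k ^ Suc l * f (Suc l) $ r)"
        by (simp add: sum_distrib_left mult_ac)
      also have "\<dots> = (\<Sum>l<Suc m. z k ^ l * f l $ r) - f 0 $ r"
        by (subst sum.lessThan_Suc_shift) simp
      also have "\<dots> = (\<Sum>l<m. z k ^ l * f l $ r)"
        using per[OF w(1)] zk by (simp add: f_def)
      finally show "lin_comb n {..<m} (\<lambda>l. z k ^ l) (\<lambda>l. f (Suc l)) $ r = (inverse (z k) \<cdot>\<^sub>v u k) $ r"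
        using r z0 by (simp add: u_def lin_comb_def field_simps)
    qed (simp add: u_def lin_comb_def)
    finally have "A *\<^sub>v u k = inverse (z k) \<cdot>\<^sub>v u k" .
    moreover have "u k \<in> W" unfolding u_def by (intro lin_comb_in_subspace[OF W]) (use fW in auto)
    ultimately show False using nz contra by blast
  qed
  \<comment> \<open>Orthogonality of roots of unity: for \<open>l\<close> between 1 and m - 1 this
    is a full geometric sum with ratio \<open>z l\<close>, an m-th root of unity other than
    1.\<close>
  have char: "(\<Sum>k<m. z k ^ l) = (if l = 0 then of_nat m else 0)" if l: "l < m" for l
  proof (cases "l = 0")
    case False
    have eq: "z k ^ l = z l ^ k" for k
      by (simp add: z_def DeMoivre mult_ac)
    have "z l \<noteq> z 0" using bij l False m
      by (metis bij_betw_def inj_onD lessThan_iff)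
    hence "z l \<noteq> 1" by (simp add: z_def)
    moreover have "z l ^ m = 1" using bij l by (auto simp: bij_betw_def)
    ultimately show ?thesis using False by (simp add: eq sum_gp_strict)
  qed simp
  have "w = 0\<^sub>v n"
  proof (rule eq_vecI)
    fix r assume "r < dim_vec (0\<^sub>v n :: complex vec)"
    hence r: "r < n" by simp
    have "0 = (\<Sum>k<m. u k $ r)" using u0 r by simp
    also have "\<dots> = (\<Sum>k<m. \<Sum>l<m. z k ^ l * f l $ r)" using r by (simp add: u_def lin_comb_def)
    also have "\<dots> = (\<Sum>l<m. (\<Sum>k<m. z k ^ l) * f l $ r)"
      by (subst sum.swap) (simp add: sum_distrib_right)
    also have "\<dots> = (\<Sum>l<m. (if l = 0 then of_nat m else 0) * f l $ r)" using char by simp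
    also have "\<dots> = of_nat m * f 0 $ r"
      using m by (simp add: if_distrib[of "\<lambda>x. x * _"] cong: if_cong)
    finally show "w $ r = 0\<^sub>v n $ r" using m r by (simp add: f_def)
  qed (use W w in \<open>auto simp: vsubspace_def\<close>)
  thus False using w by simp
qed

section \<open>Monomial representations\<close>

context group
begin

lemma inv_cancel_left:
  assumes "x \<in> carrier G" "y \<in> carrier G"
  shows "x \<otimes> (inv x \<otimes> y) = y" "inv x \<otimes> (x \<otimes> y) = y"
  using assms by (simp_all add: m_assoc[symmetric])

text \<open>The condition \<open>inv r i \<otimes> g \<in> T\<close> says that g lies in the left
  coset of \<open>r i\<close>. Inversion turns representatives of right cosets, which
  \<open>rcosets\<close> provides, into such a system.\<close>

lemma left_transversal:
  assumes fin: "finite (carrier G)" and T: "subgroup T G"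
  shows "\<exists>m r. m * card T = order G \<and> (\<forall>i<m. r i \<in> carrier G) \<and>
    (\<forall>g\<in>carrier G. \<exists>i<m. inv r i \<otimes> g \<in> T) \<and>
    (\<forall>g\<in>carrier G. \<forall>i<m. \<forall>j<m. inv r i \<otimes> g \<in> T \<longrightarrow> inv r j \<otimes> g \<in> T \<longrightarrow> i = j)"
proof -
  define m where "m = card (rcosets T)"
  have TG: "T \<subseteq> carrier G" using T subgroup.subset by blast
  have "finite (rcosets T)" using fin by (simp add: RCOSETS_def)
  then obtain h where h: "bij_betw h {0..<m} (rcosets T)"
    unfolding m_def using ex_bij_betw_nat_finite by blast
  have "\<exists>s\<in>carrier G. h i = T #> s" if "i < m" for i
    proof -
      have "h i \<in> rcosets T" using bij_betwE[OF h] that by simp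
      thus ?thesis unfolding RCOSETS_def by blast
    qed
  then obtain s where s: "\<And>i. i < m \<Longrightarrow> s i \<in> carrier G" "\<And>i. i < m \<Longrightarrow> h i = T #> s i" by metis
  have iff: "s i \<otimes> g \<in> T \<longleftrightarrow> inv g \<in> h i" if "i < m" "g \<in> carrier G" for i g
  proof -
    have "inv g \<in> h i \<longleftrightarrow> inv g \<otimes> inv s i \<in> T"
      using subgroup.rcos_module[OF T is_group s(1)[OF that(1)]] s(2)[OF that(1)] that(2) by simp
    also have "inv g \<otimes> inv s i = inv (s i \<otimes> g)" using s(1) that by (simp add: inv_mult_group)
    also have "\<dots> \<in> T \<longleftrightarrow> s i \<otimes> g \<in> T"
    proof -
      have "s i \<otimes> g \<in> carrier G" using s(1) that by blast
      thus ?thesis using subgroup.m_inv_closed[OF T] inv_inv by metis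
    qed
    finally show ?thesis by simp
  qed
  show ?thesis
  proof (rule exI[of _ m], rule exI[of _ "\<lambda>i. inv s i"], intro conjI allI ballI impI)
    show "m * card T = order G" using lagrange[OF T] by (simp add: m_def mult.commute)
    show "inv s i \<in> carrier G" if "i < m" for i using s that by simp
    show "\<exists>i<m. inv (inv s i) \<otimes> g \<in> T" if g: "g \<in> carrier G" for g
    proof -
      have "inv g \<in> \<Union>(rcosets T)" using rcosets_part_G[OF T] g by simp
      moreover have "rcosets T = h ` {0..<m}" using h by (simp add: bij_betw_def)
      ultimately obtain i where "i < m" "inv g \<in> h i" by auto
      thus ?thesis using iff g s by auto
    qed
    show "i = j" if "g \<in> carrier G" "i < m" "j < m" "inv (inv s i) \<otimes> g \<in> T" "inv (inv s j) \<otimes> g \<in> T" for g i j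
    proof -
      have "s i \<otimes> g \<in> T" "s j \<otimes> g \<in> T" using that s(1) by simp_all
      hence "inv g \<in> h i" "inv g \<in> h j" using iff that by blast+
      moreover have "h i \<in> rcosets T" "h j \<in> rcosets T" using h that by (auto simp: bij_betw_def)
      ultimately have "h i = h j" using rcos_disjoint[OF T] by (auto simp: pairwise_def disjnt_def)
      thus ?thesis using h that by (auto simp: bij_betw_def inj_on_def)
    qed
  qed
qed

text \<open>If the conjugates of \<mu> by \<open>a\<close> and \<open>b\<close> agreed on N,
  substituting \<open>b \<otimes> y \<otimes> inv b\<close> for y would show that
  \<open>inv b \<otimes> a\<close> stabilises \<mu>. Translates of a weight vector by different
  cosets of T thus have different weights.\<close>

lemma conjugate_weights_distinct:
  assumes N: "N \<lhd> G"
    and stab: "\<And>g. g \<in> carrier G \<Longrightarrow> (\<And>y. y \<in> N \<Longrightarrow> \<mu> (inv g \<otimes> y \<otimes> g) = \<mu> y) \<Longrightarrow> g \<in> T"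
    and a: "a \<in> carrier G" and b: "b \<in> carrier G" and nT: "inv b \<otimes> a \<notin> T"
  shows "\<exists>y\<in>N. \<mu> (inv a \<otimes> y \<otimes> a) \<noteq> \<mu> (inv b \<otimes> y \<otimes> b)"
proof (rule ccontr)
  assume "\<not> ?thesis"
  hence eq: "\<mu> (inv a \<otimes> y \<otimes> a) = \<mu> (inv b \<otimes> y \<otimes> b)" if "y \<in> N" for y using that by simp
  have "inv b \<otimes> a \<in> T"
  proof (rule stab)
    fix y assume y: "y \<in> N"
    hence yG: "y \<in> carrier G" by (rule subgroup.mem_carrier[OF normal_imp_subgroup[OF N]])
    have "b \<otimes> y \<otimes> inv b \<in> N" by (rule normal.inv_op_closed2[OF N b y])
    note eq[OF this]
    moreover have "inv a \<otimes> (b \<otimes> y \<otimes> inv b) \<otimes> a = inv (inv b \<otimes> a) \<otimes> y \<otimes> (inv b \<otimes> a)"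
      using a b yG by (simp add: inv_mult_group m_assoc inv_cancel_left)
    moreover have "inv b \<otimes> (b \<otimes> y \<otimes> inv b) \<otimes> b = y"
      using b yG by (simp add: m_assoc inv_cancel_left)
    ultimately show "\<mu> (inv (inv b \<otimes> a) \<otimes> y \<otimes> (inv b \<otimes> a)) = \<mu> y" by simp
  qed (use a b in simp)
  with nT show False ..
qed

end

locale finite_group_rep = group G for G (structure) +
  fixes n :: nat and \<rho> :: "'a \<Rightarrow> complex mat"
  assumes fin: "finite (carrier G)" and rep: "matrix_rep G n \<rho>"
begin

lemma rho_carrier [simp]: "g \<in> carrier G \<Longrightarrow> \<rho> g \<in> carrier_mat n n"
  using rep by (simp add: matrix_rep_def)

lemma rho_vec [simp]: "g \<in> carrier G \<Longrightarrow> v \<in> carrier_vec n \<Longrightarrow> \<rho> g *\<^sub>v v \<in> carrier_vec n"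
  by (rule mult_mat_vec_carrier[OF rho_carrier])

lemma rho_one: "v \<in> carrier_vec n \<Longrightarrow> \<rho> \<one> *\<^sub>v v = v"
  using rep by (simp add: matrix_rep_def)

lemma rho_mult:
  "g \<in> carrier G \<Longrightarrow> h \<in> carrier G \<Longrightarrow> v \<in> carrier_vec n \<Longrightarrow> \<rho> (g \<otimes> h) *\<^sub>v v = \<rho> g *\<^sub>v (\<rho> h *\<^sub>v v)"
  using rep assoc_mult_mat_vec[of "\<rho> g" n n "\<rho> h" n v] by (simp add: matrix_rep_def)

lemma rho_smult:
  "g \<in> carrier G \<Longrightarrow> v \<in> carrier_vec n \<Longrightarrow> \<rho> g *\<^sub>v (c \<cdot>\<^sub>v v) = c \<cdot>\<^sub>v (\<rho> g *\<^sub>v v)"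
  by (rule mult_mat_vec[OF rho_carrier])

lemma rho_add:
  "g \<in> carrier G \<Longrightarrow> v \<in> carrier_vec n \<Longrightarrow> w \<in> carrier_vec n \<Longrightarrow> \<rho> g *\<^sub>v (v + w) = \<rho> g *\<^sub>v v + \<rho> g *\<^sub>v w"
  by (rule mult_add_distrib_mat_vec[OF rho_carrier])

lemma rho_zero: "g \<in> carrier G \<Longrightarrow> \<rho> g *\<^sub>v 0\<^sub>v n = 0\<^sub>v n"
  using rho_smult[of g "0\<^sub>v n" 0] rho_carrier[of g] by (auto intro!: eq_vecI simp del: rho_carrier)

lemma rho_power:
  "g \<in> carrier G \<Longrightarrow> v \<in> carrier_vec n \<Longrightarrow> ((*\<^sub>v) (\<rho> g) ^^ k) v = \<rho> (g [^] k) *\<^sub>v v"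
proof (induction k)
  case (Suc k)
  moreover have "g [^] Suc k = g \<otimes> g [^] k" using Suc.prems by (simp only: nat_pow_Suc2)
  ultimately show ?case by (simp add: rho_mult)
qed (simp add: rho_one)

text \<open>The vectors transforming by \<open>\<kappa>\<close> under \<open>K\<close> form a \<open>T\<close>-invariant space on which \<open>T\<close> acts
  through commuting matrices of finite order.\<close>

lemma common_eigenvector:
  assumes T: "T \<subseteq> carrier G" and K: "K \<subseteq> carrier G"
    and w: "w \<in> carrier_vec n" "w \<noteq> 0\<^sub>v n" "\<And>k. k \<in> K \<Longrightarrow> \<rho> k *\<^sub>v w = \<kappa> k \<cdot>\<^sub>v w"
    and conj: "\<And>t k. t \<in> T \<Longrightarrow> k \<in> K \<Longrightarrow> inv t \<otimes> k \<otimes> t \<in> K \<and> \<kappa> (inv t \<otimes> k \<otimes> t) = \<kappa> k"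
    and comm: "\<And>s t. s \<in> T \<Longrightarrow> t \<in> T \<Longrightarrow> \<exists>k\<in>K. s \<otimes> t = t \<otimes> s \<otimes> k \<and> \<kappa> k = 1"
  shows "\<exists>v \<mu>. v \<in> carrier_vec n \<and> v \<noteq> 0\<^sub>v n \<and> (\<forall>k\<in>K. \<rho> k *\<^sub>v v = \<kappa> k \<cdot>\<^sub>v v) \<and>
    (\<forall>t\<in>T. \<rho> t *\<^sub>v v = \<mu> t \<cdot>\<^sub>v v)"
proof -
  define U where "U = {v \<in> carrier_vec n. \<forall>k\<in>K. \<rho> k *\<^sub>v v = \<kappa> k \<cdot>\<^sub>v v}"
  have UT: "\<rho> t *\<^sub>v u \<in> U" if t: "t \<in> T" and u: "u \<in> U" for t u
  proof -
    have tG: "t \<in> carrier G" using t T by blast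
    have uc: "u \<in> carrier_vec n" using u by (simp add: U_def)
    have "\<rho> k *\<^sub>v (\<rho> t *\<^sub>v u) = \<kappa> k \<cdot>\<^sub>v (\<rho> t *\<^sub>v u)" if k: "k \<in> K" for k
    proof -
      have kG: "k \<in> carrier G" using k K by blast
      have "\<rho> k *\<^sub>v (\<rho> t *\<^sub>v u) = \<rho> (k \<otimes> t) *\<^sub>v u" using tG kG uc by (simp add: rho_mult)
      also have "k \<otimes> t = t \<otimes> (inv t \<otimes> k \<otimes> t)" using tG kG by (simp add: m_assoc inv_cancel_left)
      also have "\<rho> \<dots> *\<^sub>v u = \<rho> t *\<^sub>v (\<rho> (inv t \<otimes> k \<otimes> t) *\<^sub>v u)" using tG kG uc by (simp add: rho_mult)
      also have "\<dots> = \<rho> t *\<^sub>v (\<kappa> k \<cdot>\<^sub>v u)" using conj[OF t k] u by (simp add: U_def)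
      finally show ?thesis using tG uc by (simp add: rho_smult)
    qed
    thus ?thesis using tG uc by (simp add: U_def)
  qed
  have commute: "\<rho> s *\<^sub>v (\<rho> t *\<^sub>v u) = \<rho> t *\<^sub>v (\<rho> s *\<^sub>v u)" if st: "s \<in> T" "t \<in> T" and u: "u \<in> U" for s t u
  proof -
    obtain k where k: "k \<in> K" "s \<otimes> t = t \<otimes> s \<otimes> k" "\<kappa> k = 1" using comm st by blast
    have G: "s \<in> carrier G" "t \<in> carrier G" "k \<in> carrier G" using st k T K by auto
    have uc: "u \<in> carrier_vec n" using u by (simp add: U_def)
    have "\<rho> k *\<^sub>v u = u" using u k by (simp add: U_def)
    hence "\<rho> (t \<otimes> s \<otimes> k) *\<^sub>v u = \<rho> (t \<otimes> s) *\<^sub>v u" using G uc by (simp add: rho_mult)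
    thus ?thesis using k(2) G uc rho_mult[of s t u] rho_mult[of t s u] by simp
  qed
  have U: "vsubspace n U"
    unfolding vsubspace_def U_def using K
    by (auto simp: rho_zero rho_add rho_smult smult_add_distrib_vec[of _ n] smult_smult_assoc mult.commute subset_iff)
  have "finite T" using T fin finite_subset by blast
  have "S \<subseteq> T \<Longrightarrow> \<exists>v\<in>U. v \<noteq> 0\<^sub>v n \<and> (\<forall>s\<in>S. \<exists>c. \<rho> s *\<^sub>v v = c \<cdot>\<^sub>v v)" if "finite S" for S
    using that
  proof (induction S)
    case empty
    show ?case using w by (auto simp: U_def)
  next
    case (insert t S)
    then obtain v where v: "v \<in> U" "v \<noteq> 0\<^sub>v n" "\<forall>s\<in>S. \<exists>c. \<rho> s *\<^sub>v v = c \<cdot>\<^sub>v v" by blast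
    then obtain c where c: "\<And>s. s \<in> S \<Longrightarrow> \<rho> s *\<^sub>v v = c s \<cdot>\<^sub>v v" by metis
    \<comment> \<open>The joint eigenspace of \<open>S\<close> for the eigenvalues already found.
      Since T commutes on \<open>U\<close>, \<open>\<rho> t\<close> maps it to itself, and its order
      divides \<open>order G\<close>, so it has an eigenvector there.\<close>
    define W where "W = {u \<in> U. \<forall>s\<in>S. \<rho> s *\<^sub>v u = c s \<cdot>\<^sub>v u}"
    have t: "t \<in> T" and tG: "t \<in> carrier G" using insert.prems T by auto
    have SG: "S \<subseteq> carrier G" using insert.prems T by auto
    have Uc: "u \<in> carrier_vec n" if "u \<in> U" for u using that by (simp add: U_def)
    have W: "vsubspace n W"
      using U SG unfolding vsubspace_def W_def
      by (auto simp: rho_zero rho_add rho_smult smult_add_distrib_vec[of _ n] smult_smult_assoc mult.commute subset_iff)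
    have "\<exists>x d. x \<in> W \<and> x \<noteq> 0\<^sub>v n \<and> \<rho> t *\<^sub>v x = d \<cdot>\<^sub>v x"
    proof (rule finite_order_eigenvector[OF rho_carrier[OF tG] W])
      show "order G > 0" using fin order_gt_0_iff_finite by blast
      show "\<rho> t *\<^sub>v x \<in> W" if x: "x \<in> W" for x
      proof -
        have "\<rho> s *\<^sub>v (\<rho> t *\<^sub>v x) = c s \<cdot>\<^sub>v (\<rho> t *\<^sub>v x)" if s: "s \<in> S" for s
        proof -
          have "\<rho> s *\<^sub>v (\<rho> t *\<^sub>v x) = \<rho> t *\<^sub>v (\<rho> s *\<^sub>v x)"
            using commute[of s t x] s t x insert.prems by (auto simp: W_def)
          also have "\<dots> = c s \<cdot>\<^sub>v (\<rho> t *\<^sub>v x)" using s x tG by (simp add: W_def rho_smult Uc)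
          finally show ?thesis .
        qed
        thus ?thesis using UT[OF t] x by (simp add: W_def)
      qed
      show "((*\<^sub>v) (\<rho> t) ^^ order G) x = x" if "x \<in> W" for x
        using that tG by (simp add: rho_power W_def Uc pow_order_eq_1 rho_one)
      show "v \<in> W" using v c by (simp add: W_def)
    qed (rule v)
    then obtain x d where "x \<in> W" "x \<noteq> 0\<^sub>v n" "\<rho> t *\<^sub>v x = d \<cdot>\<^sub>v x" by blast
    thus ?case by (auto simp: W_def intro!: bexI[of _ x])
  qed
  from this[OF \<open>finite T\<close> subset_refl] obtain v where v: "v \<in> U" "v \<noteq> 0\<^sub>v n" "\<forall>s\<in>T. \<exists>c. \<rho> s *\<^sub>v v = c \<cdot>\<^sub>v v"
    by blast
  then obtain \<mu> where "\<And>t. t \<in> T \<Longrightarrow> \<rho> t *\<^sub>v v = \<mu> t \<cdot>\<^sub>v v" by metis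
  with v show ?thesis by (auto simp: U_def)
qed

text \<open>The translates of \<open>w\<close> by coset representatives of T span an invariant
  subspace, hence the whole space. They carry pairwise distinct weights of N, so they are
  independent and form a basis indexed by the cosets.\<close>

lemma degree_eq_index:
  assumes irr: "irreducible_rep G n \<rho>" and T: "subgroup T G" and N: "N \<lhd> G" "N \<subseteq> T"
    and w: "w \<in> carrier_vec n" "w \<noteq> 0\<^sub>v n" "\<And>t. t \<in> T \<Longrightarrow> \<rho> t *\<^sub>v w = \<mu> t \<cdot>\<^sub>v w"
    and stab: "\<And>g. g \<in> carrier G \<Longrightarrow> (\<And>y. y \<in> N \<Longrightarrow> \<mu> (inv g \<otimes> y \<otimes> g) = \<mu> y) \<Longrightarrow> g \<in> T"
  shows "n * card T = order G"
proof -
  obtain m r where tr: "m * card T = order G \<and> (\<forall>i<m. r i \<in> carrier G) \<and>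
    (\<forall>g\<in>carrier G. \<exists>i<m. inv r i \<otimes> g \<in> T) \<and>
    (\<forall>g\<in>carrier G. \<forall>i<m. \<forall>j<m. inv r i \<otimes> g \<in> T \<longrightarrow> inv r j \<otimes> g \<in> T \<longrightarrow> i = j)"
    using left_transversal[OF fin T] by (elim exE)
  have m: "m * card T = order G" and r: "\<And>i. i < m \<Longrightarrow> r i \<in> carrier G"
    and ex: "\<And>g. g \<in> carrier G \<Longrightarrow> \<exists>i<m. inv r i \<otimes> g \<in> T"
    and uniq: "\<And>g i j. g \<in> carrier G \<Longrightarrow> i < m \<Longrightarrow> j < m \<Longrightarrow> inv r i \<otimes> g \<in> T \<Longrightarrow> inv r j \<otimes> g \<in> T \<Longrightarrow> i = j"
    using tr by simp_all
  have TG: "T \<subseteq> carrier G" using T subgroup.subset by blast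
  have NG: "N \<subseteq> carrier G" using N TG by blast
  define e where "e i = \<rho> (r i) *\<^sub>v w" for i
  have ec: "e i \<in> carrier_vec n" if "i < m" for i using r[OF that] w by (simp add: e_def)
  have e0: "e i \<noteq> 0\<^sub>v n" if i: "i < m" for i
  proof
    assume "e i = 0\<^sub>v n"
    hence "\<rho> (inv r i) *\<^sub>v (\<rho> (r i) *\<^sub>v w) = 0\<^sub>v n" using r[OF i] by (simp add: e_def rho_zero)
    thus False using r[OF i] w rho_mult[of "inv r i" "r i" w] by (simp add: rho_one)
  qed
  have orbit: "\<exists>j<m. \<exists>c. \<rho> g *\<^sub>v w = c \<cdot>\<^sub>v e j" if g: "g \<in> carrier G" for g
  proof -
    obtain j where j: "j < m" "inv r j \<otimes> g \<in> T" using ex g by blast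
    have "g = r j \<otimes> (inv r j \<otimes> g)" using r[OF j(1)] g by (simp add: m_assoc[symmetric])
    hence "\<rho> g *\<^sub>v w = \<rho> (r j) *\<^sub>v (\<rho> (inv r j \<otimes> g) *\<^sub>v w)"
      using r[OF j(1)] g w rho_mult[of "r j" "inv r j \<otimes> g" w] by simp
    also have "\<dots> = \<mu> (inv r j \<otimes> g) \<cdot>\<^sub>v e j" using w j r[OF j(1)] by (simp add: e_def rho_smult)
    finally show ?thesis using j by blast
  qed
  define W where "W = range (\<lambda>x. lin_comb n {..<m} x e)"
  have W: "vsubspace n W"
  proof -
    have "0\<^sub>v n \<in> W"
      unfolding W_def by (rule range_eqI[of _ _ "\<lambda>_. 0"]) (auto simp: lin_comb_def)
    thus ?thesis unfolding vsubspace_def by (auto simp: W_def lin_comb_add lin_comb_smult)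
  qed
  have eW: "e i \<in> W" if i: "i < m" for i
  proof -
    have "e i = lin_comb n {..<m} (\<lambda>j. if j = i then 1 else 0) e"
      using i ec[OF i] by (auto simp: lin_comb_def if_distrib[of "\<lambda>x. x * _"] cong: if_cong)
    thus ?thesis by (auto simp: W_def)
  qed
  have "invariant_subspace G n \<rho> W"
  proof -
    have "\<rho> g *\<^sub>v v \<in> W" if g: "g \<in> carrier G" and v: "v \<in> W" for g v
    proof -
      obtain x where x: "v = lin_comb n {..<m} x e" using v by (auto simp: W_def)
      have "\<rho> g *\<^sub>v e i \<in> W" if i: "i < m" for i
      proof -
        have "\<rho> g *\<^sub>v e i = \<rho> (g \<otimes> r i) *\<^sub>v w" using g r[OF i] w by (simp add: e_def rho_mult)
        moreover obtain j c where "j < m" "\<rho> (g \<otimes> r i) *\<^sub>v w = c \<cdot>\<^sub>v e j"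
          using orbit[of "g \<otimes> r i"] g r[OF i] by auto
        ultimately show ?thesis using eW W by (simp add: vsubspace_def)
      qed
      thus ?thesis unfolding x
        using ec by (subst mult_mat_vec_lin_comb[OF rho_carrier[OF g]]) (auto intro: lin_comb_in_subspace[OF W])
    qed
    thus ?thesis using W unfolding invariant_subspace_def vsubspace_def by blast
  qed
  moreover obtain i where i: "i < m" using ex[of \<one>] by auto
  ultimately have W_all: "W = carrier_vec n"
    using irr eW[OF i] e0[OF i] unfolding irreducible_rep_def by (metis singletonD)
  define l where "l i y = \<mu> (inv r i \<otimes> y \<otimes> r i)" for i y
  have weight: "\<rho> y *\<^sub>v e i = l i y \<cdot>\<^sub>v e i" if i: "i < m" and y: "y \<in> N" for i y
  proof -
    have yG: "y \<in> carrier G" using y NG by blast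
    have T': "inv r i \<otimes> y \<otimes> r i \<in> T" using normal.inv_op_closed1[OF N(1) r[OF i] y] N(2) by blast
    have "\<rho> y *\<^sub>v e i = \<rho> (y \<otimes> r i) *\<^sub>v w" using r[OF i] yG w by (simp add: e_def rho_mult)
    also have "y \<otimes> r i = r i \<otimes> (inv r i \<otimes> y \<otimes> r i)"
      using r[OF i] yG by (simp add: m_assoc inv_cancel_left)
    also have "\<rho> \<dots> *\<^sub>v w = \<rho> (r i) *\<^sub>v (\<rho> (inv r i \<otimes> y \<otimes> r i) *\<^sub>v w)" using r[OF i] yG w by (simp add: rho_mult)
    also have "\<dots> = l i y \<cdot>\<^sub>v e i" using w T' r[OF i] by (simp add: l_def e_def rho_smult)
    finally show ?thesis .
  qed
  have "n = m"
  proof (rule basis_card[of m e n])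
    show "x i = 0" if x: "lin_comb n {..<m} x e = 0\<^sub>v n" and i: "i < m" for x i
    proof -
      \<comment> \<open>Taking the zero space as the invariant subspace turns the separation of
        weights into linear independence.\<close>
      have "x i \<cdot>\<^sub>v e i \<in> {0\<^sub>v n}"
      proof (rule weight_component_in_subspace[where W = "{0\<^sub>v n}" and N = N and \<rho> = \<rho> and l = l and I = "{..<m}"])
        show "\<exists>y\<in>N. l i y \<noteq> l j y" if "i \<in> {..<m}" "j \<in> {..<m}" "i \<noteq> j" for i j
          unfolding l_def
        proof (rule conjugate_weights_distinct[OF N(1), of _ T])
          show "inv r j \<otimes> r i \<notin> T"
            using uniq[of "r i" i j] that r[of i] subgroup.one_closed[OF T] by auto
        qed (rule stab, use r that in auto)
        show "vsubspace n {0\<^sub>v n}" by (auto simp: vsubspace_def)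
        show "\<rho> y *\<^sub>v v \<in> {0\<^sub>v n}" if "y \<in> N" "v \<in> {0\<^sub>v n}" for y v using that NG rho_zero by blast
      next
        show "\<rho> y \<in> carrier_mat n n" if "y \<in> N" for y using that NG by auto
      qed (simp_all add: ec weight x i)
      hence "x i \<cdot>\<^sub>v e i = 0\<^sub>v n" by simp
      hence "inverse (x i) \<cdot>\<^sub>v (x i \<cdot>\<^sub>v e i) = 0\<^sub>v n" by (auto intro!: eq_vecI)
      thus ?thesis using e0[OF i] by (cases "x i = 0") (auto simp: smult_smult_assoc)
    qed
  qed (use ec W_all in \<open>auto simp: W_def\<close>)
  thus ?thesis using m by simp
qed

end

text \<open>The induced representation in monomial matrices. The unit vectors have distinct weights
  under N, so a nonzero invariant subspace contains one of them, and G permutes them transitively up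
  to scalars.\<close>

lemma (in group) induced_irreducible_rep:
  fixes \<mu> :: "'a \<Rightarrow> complex"
  assumes fin: "finite (carrier G)" and T: "subgroup T G" and N: "N \<lhd> G" "N \<subseteq> T"
    and hom: "\<And>s t. s \<in> T \<Longrightarrow> t \<in> T \<Longrightarrow> \<mu> (s \<otimes> t) = \<mu> s * \<mu> t" and one: "\<mu> \<one> = 1"
    and stab: "\<And>g. g \<in> carrier G \<Longrightarrow> (\<And>y. y \<in> N \<Longrightarrow> \<mu> (inv g \<otimes> y \<otimes> g) = \<mu> y) \<Longrightarrow> g \<in> T"
  shows "order G div card T \<in> char_degrees G"
proof -
  obtain m r where tr: "m * card T = order G \<and> (\<forall>i<m. r i \<in> carrier G) \<and>
    (\<forall>g\<in>carrier G. \<exists>i<m. inv r i \<otimes> g \<in> T) \<and>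
    (\<forall>g\<in>carrier G. \<forall>i<m. \<forall>j<m. inv r i \<otimes> g \<in> T \<longrightarrow> inv r j \<otimes> g \<in> T \<longrightarrow> i = j)"
    using left_transversal[OF fin T] by (elim exE)
  have m: "m * card T = order G" and r: "\<And>i. i < m \<Longrightarrow> r i \<in> carrier G"
    and ex: "\<And>g. g \<in> carrier G \<Longrightarrow> \<exists>i<m. inv r i \<otimes> g \<in> T"
    and uniq: "\<And>g i j. g \<in> carrier G \<Longrightarrow> i < m \<Longrightarrow> j < m \<Longrightarrow> inv r i \<otimes> g \<in> T \<Longrightarrow> inv r j \<otimes> g \<in> T \<Longrightarrow> i = j"
    using tr by simp_all
  have TG: "T \<subseteq> carrier G" using T subgroup.subset by blast
  have T1: "\<one> \<in> T" using T subgroup.one_closed by blast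
  have rT: "inv r i \<otimes> r j \<in> T \<longleftrightarrow> i = j" if "i < m" "j < m" for i j
    using uniq[of "r j" i j] that r T1 by auto
  \<comment> \<open>Extension of \<mu> by zero: the entry of \<open>\<rho> g\<close> at (i, j)
    vanishes unless g carries the coset of \<open>r j\<close> to that of \<open>r i\<close>.\<close>
  define d where "d x = (if x \<in> T then \<mu> x else 0)" for x
  have d_mult: "d (x \<otimes> t) = d x * d t" if x: "x \<in> carrier G" and t: "t \<in> T" for x t
  proof -
    have "x \<otimes> t \<in> T \<longleftrightarrow> x \<in> T"
    proof
      assume "x \<otimes> t \<in> T"
      hence "x \<otimes> t \<otimes> inv t \<in> T" using t T by (simp add: subgroup.m_closed subgroup.m_inv_closed)
      thus "x \<in> T" using x t TG by (simp add: m_assoc subset_iff)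
    qed (use t T in \<open>simp add: subgroup.m_closed\<close>)
    thus ?thesis using hom t by (simp add: d_def)
  qed
  define \<rho> where "\<rho> g = mat m m (\<lambda>(i,j). d (inv r i \<otimes> g \<otimes> r j))" for g
  have rho_c: "\<rho> g \<in> carrier_mat m m" for g by (simp add: \<rho>_def)
  have rep: "matrix_rep G m \<rho>"
    unfolding matrix_rep_def
  proof (intro conjI ballI)
    show "\<rho> \<one> = 1\<^sub>m m"
      by (rule eq_matI) (auto simp: \<rho>_def d_def r rT one)
    fix g h assume g: "g \<in> carrier G" and h: "h \<in> carrier G"
    show "\<rho> (g \<otimes> h) = \<rho> g * \<rho> h"
    proof (rule eq_matI)
      fix i j assume "i < dim_row (\<rho> g * \<rho> h)" "j < dim_col (\<rho> g * \<rho> h)"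
      hence ij: "i < m" "j < m" by (auto simp: \<rho>_def)
      obtain k where k: "k < m" "inv r k \<otimes> (h \<otimes> r j) \<in> T" using ex[of "h \<otimes> r j"] h r ij by auto
      have other: "d (inv r k' \<otimes> h \<otimes> r j) = 0" if "k' < m" "k' \<noteq> k" for k'
        using uniq[of "h \<otimes> r j" k' k] that k h r ij by (auto simp: d_def m_assoc)
      have "(\<rho> g * \<rho> h) $$ (i, j) = (\<Sum>k'<m. d (inv r i \<otimes> g \<otimes> r k') * d (inv r k' \<otimes> h \<otimes> r j))"
        using ij by (simp add: \<rho>_def scalar_prod_def lessThan_atLeast0)
      \<comment> \<open>Each column of a monomial matrix has one nonzero entry, here in the row
        \<open>k\<close> of the coset containing \<open>h \<otimes> r j\<close>.\<close>
      also have "\<dots> = (\<Sum>k'\<in>{k}. d (inv r i \<otimes> g \<otimes> r k') * d (inv r k' \<otimes> h \<otimes> r j))"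
        by (rule sum.mono_neutral_right) (use k other in auto)
      also have "\<dots> = d (inv r i \<otimes> g \<otimes> r k \<otimes> (inv r k \<otimes> (h \<otimes> r j)))"
        using d_mult[of "inv r i \<otimes> g \<otimes> r k" "inv r k \<otimes> (h \<otimes> r j)"] k g h r ij by (simp add: m_assoc)
      also have "\<dots> = \<rho> (g \<otimes> h) $$ (i, j)"
        using k g h r ij by (simp add: \<rho>_def m_assoc inv_cancel_left)
      finally show "\<rho> (g \<otimes> h) $$ (i, j) = (\<rho> g * \<rho> h) $$ (i, j)" by simp
    qed (auto simp: \<rho>_def)
  qed (rule rho_c)
  have NT: "inv r i \<otimes> y \<otimes> r i \<in> T" if "i < m" "y \<in> N" for i y
    using normal.inv_op_closed1[OF N(1) r[OF that(1)] that(2)] N(2) by blast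
  define l where "l i y = \<mu> (inv r i \<otimes> y \<otimes> r i)" for i y
  have col_unit: "\<rho> g *\<^sub>v unit_vec m j = vec m (\<lambda>i. d (inv r i \<otimes> g \<otimes> r j))" if "j < m" for g j
    using that by (intro eq_vecI) (auto simp: \<rho>_def)
  have weight: "\<rho> y *\<^sub>v unit_vec m j = l j y \<cdot>\<^sub>v unit_vec m j" if j: "j < m" and y: "y \<in> N" for j y
  proof -
    have yG: "y \<in> carrier G" using y N TG by blast
    have "d (inv r i \<otimes> y \<otimes> r j) = (if i = j then l j y else 0)" if i: "i < m" for i
    proof -
      have "inv r i \<otimes> y \<otimes> r j = inv r i \<otimes> r j \<otimes> (inv r j \<otimes> y \<otimes> r j)"
        using r i j yG by (simp add: m_assoc inv_cancel_left)
      hence "d (inv r i \<otimes> y \<otimes> r j) = d (inv r i \<otimes> r j) * d (inv r j \<otimes> y \<otimes> r j)"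
        using d_mult[OF _ NT[OF j y], of "inv r i \<otimes> r j"] r i j by simp
      thus ?thesis using rT[OF i j] NT[OF j y] one r j by (auto simp: d_def l_def)
    qed
    thus ?thesis using j by (auto simp: col_unit)
  qed
  have m0: "m > 0" using ex[of \<one>] by auto
  have irr: "irreducible_rep G m \<rho>"
    unfolding irreducible_rep_def
  proof (intro conjI allI impI rep m0)
    fix W assume inv: "invariant_subspace G m \<rho> W"
    hence W: "vsubspace m W" unfolding invariant_subspace_def vsubspace_def by blast
    have Winv: "\<rho> g *\<^sub>v v \<in> W" if "g \<in> carrier G" "v \<in> W" for g v
      using inv that unfolding invariant_subspace_def by blast
    show "W = {0\<^sub>v m} \<or> W = carrier_vec m"
    proof (cases "W = {0\<^sub>v m}")
      case False
      then obtain w where w: "w \<in> W" "w \<noteq> 0\<^sub>v m" using W unfolding vsubspace_def by blast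
      have wc: "w \<in> carrier_vec m" using w W unfolding vsubspace_def by blast
      have "\<exists>k<m. w $ k \<noteq> 0"
      proof (rule ccontr)
        assume "\<not> ?thesis"
        hence "w = 0\<^sub>v m" using wc by (intro eq_vecI) auto
        with w show False by simp
      qed
      then obtain k where k: "k < m" "w $ k \<noteq> 0" by blast
      have "w $ k \<cdot>\<^sub>v unit_vec m k \<in> W"
      proof (rule weight_component_in_subspace[OF W, where N = N and \<rho> = \<rho> and l = l and I = "{..<m}"])
        show "\<exists>y\<in>N. l i y \<noteq> l j y" if "i \<in> {..<m}" "j \<in> {..<m}" "i \<noteq> j" for i j
          unfolding l_def
        proof (rule conjugate_weights_distinct[OF N(1), of _ T])
          show "inv r j \<otimes> r i \<notin> T" using rT[of j i] that by simp
        qed (rule stab, use r that in auto)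
        show "\<rho> y *\<^sub>v v \<in> W" if "y \<in> N" "v \<in> W" for y v using that N TG Winv by blast
        show "lin_comb m {..<m} (($) w) (unit_vec m) \<in> W" using unit_vec_lin_comb[OF wc] w by simp
      qed (simp_all add: weight k rho_c)
      hence "inverse (w $ k) \<cdot>\<^sub>v (w $ k \<cdot>\<^sub>v unit_vec m k) \<in> W" using W by (simp add: vsubspace_def)
      hence kW: "unit_vec m k \<in> W" using k by (simp add: smult_smult_assoc)
      have all: "unit_vec m i \<in> W" if i: "i < m" for i
      proof -
        have "d (inv r a \<otimes> (r i \<otimes> inv r k) \<otimes> r k) = (if a = i then 1 else 0)" if a: "a < m" for a
          using r[OF a] r[OF i] r[OF k(1)] rT[OF a i] one by (auto simp: m_assoc d_def)
        hence "\<rho> (r i \<otimes> inv r k) *\<^sub>v unit_vec m k = unit_vec m i"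
          unfolding col_unit[OF k(1)] using i by (intro eq_vecI) auto
        thus ?thesis using Winv[OF _ kW, of "r i \<otimes> inv r k"] r[OF i] r[OF k(1)] by simp
      qed
      have "v \<in> W" if v: "v \<in> carrier_vec m" for v
        using lin_comb_in_subspace[OF W, of "{..<m}" "unit_vec m" "($) v"] unit_vec_lin_comb[OF v] all by simp
      thus ?thesis using W by (auto simp: vsubspace_def)
    qed simp
  qed
  have "card T > 0" using T1 TG fin by (auto simp: card_gt_0_iff intro: finite_subset)
  hence "order G div card T = m" by (simp flip: m)
  thus ?thesis using irr by (auto simp: char_degrees_def)
qed

section \<open>Commutator subgroups and nilpotent quotients\<close>

lemma derived_eq_commutator: "derived G H = commutator_subgroup G H H"
  by (simp add: derived_def commutator_subgroup_def)

context group
begin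

text \<open>Reduces a commutator to comparing the two products of g and h, so no inverse has to be
  computed in the matrix group.\<close>

lemma commutator_eqI:
  assumes "c \<otimes> (h \<otimes> g) = g \<otimes> h" "g \<in> carrier G" "h \<in> carrier G" "c \<in> carrier G"
  shows "g \<otimes> h \<otimes> inv g \<otimes> inv h = c"
proof -
  have "g \<otimes> h \<otimes> inv g \<otimes> inv h = c \<otimes> (h \<otimes> g) \<otimes> (inv g \<otimes> inv h)"
    using assms by (simp add: m_assoc)
  also have "\<dots> = c \<otimes> (h \<otimes> (g \<otimes> inv g) \<otimes> inv h)" using assms(2-4) by (simp only: m_assoc m_closed inv_closed)
  also have "\<dots> = c" using assms(2-4) by simp
  finally show ?thesis .
qed

lemma commutator_subgroup_subset:
  assumes "subgroup K G" "\<And>a b. a \<in> A \<Longrightarrow> b \<in> B \<Longrightarrow> a \<otimes> b \<otimes> inv a \<otimes> inv b \<in> K"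
  shows "commutator_subgroup G A B \<subseteq> K"
  unfolding commutator_subgroup_def by (rule generate_subgroup_incl[OF _ assms(1)]) (use assms(2) in blast)

lemma commutator_in:
  "a \<in> A \<Longrightarrow> b \<in> B \<Longrightarrow> a \<otimes> b \<otimes> inv a \<otimes> inv b \<in> commutator_subgroup G A B"
  unfolding commutator_subgroup_def by (rule generate.incl) blast

lemma one_in_lower_central: "\<one> \<in> lower_central G n"
  by (cases n) (auto simp: commutator_subgroup_def intro: generate.one)

lemma lower_central_subset:
  assumes "\<And>n. subgroup (K n) G" "K 0 = carrier G"
    and "\<And>n a b. a \<in> K n \<Longrightarrow> b \<in> carrier G \<Longrightarrow> a \<otimes> b \<otimes> inv a \<otimes> inv b \<in> K (Suc n)"
  shows "lower_central G n \<subseteq> K n"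
proof (induction n)
  case (Suc n)
  show ?case unfolding lower_central.simps
    by (rule commutator_subgroup_subset[OF assms(1)]) (use Suc assms(3) in blast)
qed (simp add: assms(2))

lemma lower_central_in_carrier: "lower_central G n \<subseteq> carrier G"
  by (rule lower_central_subset) (auto intro: subgroup_self)

text \<open>The lower central series of the quotient is the image of that of G, because the
  projection carries generating commutators onto generating commutators. Nilpotency of a factor
  thereby becomes an inclusion inside G.\<close>

lemma nilpotent_Mod_iff:
  assumes N: "N \<lhd> G"
  shows "nilpotent_group (G Mod N) \<longleftrightarrow> (\<exists>n. lower_central G n \<subseteq> N)"
proof -
  interpret N: normal N G by (rule N)
  interpret Q: group "G Mod N" by (rule N.factorgroup_is_group)
  interpret h: group_hom G "G Mod N" "\<lambda>a. N #> a"
    by unfold_locales (rule N.r_coset_hom_Mod)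
  have surj: "carrier (G Mod N) = (\<lambda>a. N #> a) ` carrier G"
    by (auto simp: FactGroup_def RCOSETS_def)
  have img: "lower_central (G Mod N) n = (\<lambda>a. N #> a) ` lower_central G n" for n
  proof (induction n)
    case (Suc n)
    let ?A = "lower_central G n"
    have A: "?A \<subseteq> carrier G" by (rule lower_central_in_carrier)
    have "(\<Union>a\<in>(#>) N ` ?A. \<Union>b\<in>(#>) N ` carrier G. {a \<otimes>\<^bsub>G Mod N\<^esub> b \<otimes>\<^bsub>G Mod N\<^esub> inv\<^bsub>G Mod N\<^esub> a \<otimes>\<^bsub>G Mod N\<^esub> inv\<^bsub>G Mod N\<^esub> b})
        = (\<lambda>a. N #> a) ` (\<Union>a\<in>?A. \<Union>b\<in>carrier G. {a \<otimes> b \<otimes> inv a \<otimes> inv b})"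
      (is "?L = ?R")
    proof -
      have key: "(N #> a) \<otimes>\<^bsub>G Mod N\<^esub> (N #> b) \<otimes>\<^bsub>G Mod N\<^esub> inv\<^bsub>G Mod N\<^esub> (N #> a) \<otimes>\<^bsub>G Mod N\<^esub> inv\<^bsub>G Mod N\<^esub> (N #> b)
          = N #> (a \<otimes> b \<otimes> inv a \<otimes> inv b)" if "a \<in> ?A" "b \<in> carrier G" for a b
      proof -
        have "a \<in> carrier G" "b \<in> carrier G" using that A by auto
        thus ?thesis by (simp only: h.hom_mult[symmetric] h.hom_inv[symmetric] m_closed inv_closed)
      qed
      have "?L = (\<Union>a\<in>?A. \<Union>b\<in>carrier G. {N #> (a \<otimes> b \<otimes> inv a \<otimes> inv b)})"
        unfolding UN_simps by (intro SUP_cong refl) (simp only: key)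
      thus ?thesis by (simp only: image_UN image_insert image_empty)
    qed
    moreover have "(\<Union>a\<in>?A. \<Union>b\<in>carrier G. {a \<otimes> b \<otimes> inv a \<otimes> inv b}) \<subseteq> carrier G"
      using A by auto
    ultimately show ?case
      using Suc.IH surj by (simp add: commutator_subgroup_def h.generate_img)
  qed (simp add: surj)
  have one: "\<one>\<^bsub>G Mod N\<^esub> = N" by (simp add: FactGroup_def)
  have "lower_central (G Mod N) n = {N} \<longleftrightarrow> lower_central G n \<subseteq> N" for n
  proof
    assume eq: "lower_central (G Mod N) n = {N}"
    show "lower_central G n \<subseteq> N"
    proof
      fix a assume a: "a \<in> lower_central G n"
      hence "N #> a = N" using eq img by auto
      thus "a \<in> N" using coset_join1[OF _ _ N.is_subgroup] a lower_central_in_carrier by blast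
    qed
  next
    assume sub: "lower_central G n \<subseteq> N"
    hence "N #> a = N" if "a \<in> lower_central G n" for a
      using that coset_join2[OF _ N.is_subgroup] by (meson N.mem_carrier subsetD)
    thus "lower_central (G Mod N) n = {N}" using one_in_lower_central img by auto
  qed
  thus ?thesis by (simp add: nilpotent_group_def one Q.is_group)
qed

end

section \<open>The group\<close>

type_synonym quat = "int \<times> int \<times> int \<times> int"

fun qm :: "quat \<Rightarrow> quat \<Rightarrow> quat" where
  "qm (x0, x1, x2, x3) (y0, y1, y2, y3) =
     (x0*y0 - x1*y1 - x2*y2 - x3*y3, x0*y1 + x1*y0 + x2*y3 - x3*y2,
      x0*y2 - x1*y3 + x2*y0 + x3*y1, x0*y3 + x1*y2 - x2*y1 + x3*y0)"

fun qc :: "quat \<Rightarrow> quat" where "qc (x0, x1, x2, x3) = (x0, -x1, -x2, -x3)"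

text \<open>\<open>qt\<close> is the anti-automorphism that corresponds to transposition of the matrices \<open>M(x)\<close> below.\<close>

fun qt :: "quat \<Rightarrow> quat" where "qt (x0, x1, x2, x3) = (x0, -x1, x2, x3)"

text \<open>The real part of \<open>qm (qt x) x\<close>. On Q8 that product is the scalar
  \<open>chi x\<close>, so M(x)^T M(x) = \<open>chi x\<close> modulo p, which is the sign by which x
  changes the dot product.\<close>

fun chi :: "quat \<Rightarrow> int" where "chi (x0, x1, x2, x3) = x0\<^sup>2 + x1\<^sup>2 - x2\<^sup>2 - x3\<^sup>2"

abbreviation q1 :: quat where "q1 \<equiv> (1, 0, 0, 0)"

definition C2 :: "quat set" where "C2 = {(1,0,0,0), (-1,0,0,0)}"

definition C4 :: "quat set" where "C4 = {(1,0,0,0), (-1,0,0,0), (0,1,0,0), (0,-1,0,0)}"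

definition Q8 :: "quat set" where
  "Q8 = {(1,0,0,0), (-1,0,0,0), (0,1,0,0), (0,-1,0,0), (0,0,1,0), (0,0,-1,0), (0,0,0,1), (0,0,0,-1)}"

lemma qm_assoc: "qm (qm x y) z = qm x (qm y z)"
  by (cases x; cases y; cases z) (simp add: algebra_simps)

lemma qm_one [simp]: "qm q1 x = x" "qm x q1 = x"
  by (cases x; simp)+

lemma qt_qm: "qt (qm x y) = qm (qt y) (qt x)"
  by (cases x; cases y) (simp add: algebra_simps)

lemma qm_Q8: "x \<in> Q8 \<Longrightarrow> y \<in> Q8 \<Longrightarrow> qm x y \<in> Q8"
  unfolding Q8_def by auto

lemma qc_Q8: "x \<in> Q8 \<Longrightarrow> qc x \<in> Q8" and qt_Q8: "x \<in> Q8 \<Longrightarrow> qt x \<in> Q8"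
  unfolding Q8_def by auto

lemma qm_qc: "x \<in> Q8 \<Longrightarrow> qm x (qc x) = q1" "x \<in> Q8 \<Longrightarrow> qm (qc x) x = q1"
  unfolding Q8_def by auto

lemma chi_qm: "x \<in> Q8 \<Longrightarrow> y \<in> Q8 \<Longrightarrow> chi (qm x y) = chi x * chi y"
  unfolding Q8_def by auto

lemma chi_qc: "chi (qc x) = chi x"
  by (cases x) simp

lemma chi_Q8: "x \<in> Q8 \<Longrightarrow> chi x = (if x \<in> C4 then 1 else -1)"
  unfolding Q8_def C4_def by auto

lemma C2_C4: "C2 \<subseteq> C4" and C4_Q8: "C4 \<subseteq> Q8"
  by (auto simp: C2_def C4_def Q8_def)

lemma commutator_Q8: "x \<in> Q8 \<Longrightarrow> y \<in> Q8 \<Longrightarrow> qm (qm x y) (qm (qc x) (qc y)) \<in> C2"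
  unfolding Q8_def C2_def by auto

lemma commutator_Q8': "x \<in> Q8 \<Longrightarrow> y \<in> Q8 \<Longrightarrow> qm (qc (qm y x)) (qm x y) \<in> C2"
  unfolding Q8_def C2_def by auto

lemma qm_C4_commute: "x \<in> C4 \<Longrightarrow> y \<in> C4 \<Longrightarrow> qm x y = qm y x"
  unfolding C4_def by auto

section \<open>The two-dimensional module of Q8 modulo p and the group of block matrices\<close>

locale q8_heisenberg =
  fixes p :: nat and a b :: int
  assumes prime_p: "Factorial_Ring.prime p" and odd_p: "p > 2"
    and ab: "int p dvd a\<^sup>2 + b\<^sup>2 + 1"
begin

text \<open>
  \<open>act1\<close> and \<open>act2\<close> are the coordinates of \<open>M(x) v\<close>, where \<open>M\<close> sends the quaternion units \<open>i\<close>, \<open>j\<close>, \<open>k\<close>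
  to the matrices with rows \<open>(0, -1), (1, 0)\<close>; \<open>(a, b), (b, -a)\<close>; \<open>(-b, a), (a, b)\<close>.
  Since \<open>a\<^sup>2 + b\<^sup>2 \<equiv> -1\<close>, this is multiplicative modulo \<open>p\<close>.\<close>

fun act1 :: "quat \<Rightarrow> int \<Rightarrow> int \<Rightarrow> int" where
  "act1 (x0, x1, x2, x3) v1 v2 = (x0 + a*x2 - b*x3) * v1 + (- x1 + b*x2 + a*x3) * v2"

fun act2 :: "quat \<Rightarrow> int \<Rightarrow> int \<Rightarrow> int" where
  "act2 (x0, x1, x2, x3) v1 v2 = (x1 + b*x2 + a*x3) * v1 + (x0 - a*x2 + b*x3) * v2"

text \<open>
  \<open>el x u1 u2 v1 v2 z\<close> stands for the block matrix with rows \<open>(\<chi>(x), u\<^sup>T, z)\<close>, \<open>(0, M(x), v)\<close>,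
  \<open>(0, 0, 1)\<close> modulo \<open>p\<close>. Its arguments need not be reduced, so products are given by polynomial formulas.\<close>

definition el :: "quat \<Rightarrow> int \<Rightarrow> int \<Rightarrow> int \<Rightarrow> int \<Rightarrow> int \<Rightarrow> nat" where
  "el x u1 u2 v1 v2 z = to_nat (x, u1 mod int p, u2 mod int p, v1 mod int p, v2 mod int p, z mod int p)"

definition mulG :: "nat \<Rightarrow> nat \<Rightarrow> nat" where
  "mulG g h = (case from_nat g of (x, u1, u2, v1, v2, z) \<Rightarrow> case from_nat h of (x', u1', u2', v1', v2', z') \<Rightarrow>
     el (qm x x')
       (chi x * u1' + act1 (qt x') u1 u2) (chi x * u2' + act2 (qt x') u1 u2)
       (act1 x v1' v2' + v1) (act2 x v1' v2' + v2)
       (chi x * z' + (u1 * v1' + u2 * v2') + z))"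

text \<open>\<open>J\<close> restricts only the row u. With \<open>UNIV\<close> this is the preimage
  of A under the projection to Q8; with \<open>{0}\<close> it is the part with u = 0, so
  \<open>elts {q1} {0}\<close> is the abelian normal subgroup of all (v, z).\<close>

definition elts :: "quat set \<Rightarrow> int set \<Rightarrow> nat set" where
  "elts A J = (\<lambda>(x, u1, u2, v1, v2, z). el x u1 u2 v1 v2 z) ` (A \<times> J \<times> J \<times> UNIV)"

definition G :: "nat monoid" where
  "G = \<lparr>carrier = elts Q8 UNIV, monoid.mult = mulG, one = el q1 0 0 0 0 0\<rparr>"

lemma carrier_G [simp]: "carrier G = elts Q8 UNIV" and one_G: "\<one>\<^bsub>G\<^esub> = el q1 0 0 0 0 0"
  by (simp_all add: G_def)

lemma el_in_elts [simp]: "x \<in> A \<Longrightarrow> u1 \<in> J \<Longrightarrow> u2 \<in> J \<Longrightarrow> el x u1 u2 v1 v2 z \<in> elts A J"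
  unfolding elts_def by (rule image_eqI[of _ _ "(x, u1, u2, v1, v2, z)"]) auto

lemma elts_cases [elim?]:
  assumes "g \<in> elts A J"
  obtains x u1 u2 v1 v2 z where "x \<in> A" "u1 \<in> J" "u2 \<in> J" "g = el x u1 u2 v1 v2 z"
  using assms unfolding elts_def by auto

lemma el_eq_iff: "el x u1 u2 v1 v2 z = el x' u1' u2' v1' v2' z' \<longleftrightarrow>
    x = x' \<and> [u1 = u1'] (mod int p) \<and> [u2 = u2'] (mod int p) \<and>
    [v1 = v1'] (mod int p) \<and> [v2 = v2'] (mod int p) \<and> [z = z'] (mod int p)"
  by (auto simp: el_def cong_def)

lemma act_cong:
  assumes "[v1 = v1'] (mod int p)" "[v2 = v2'] (mod int p)"
  shows "[act1 x v1 v2 = act1 x v1' v2'] (mod int p)" "[act2 x v1 v2 = act2 x v1' v2'] (mod int p)"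
  by (cases x; simp; intro cong_add cong_mult cong_refl assms)+

lemma act_zero [simp]: "act1 x 0 0 = 0" "act2 x 0 0 = 0"
  by (cases x; simp)+

lemma act_add: "act1 x (v1 + w1) (v2 + w2) = act1 x v1 v2 + act1 x w1 w2"
  "act2 x (v1 + w1) (v2 + w2) = act2 x v1 v2 + act2 x w1 w2"
  by (cases x; simp add: algebra_simps)+

lemma act_scale: "act1 x (c * v1) (c * v2) = c * act1 x v1 v2" "act2 x (c * v1) (c * v2) = c * act2 x v1 v2"
  by (cases x; simp add: algebra_simps)+

lemma act_adjoint: "act1 (qt x) u1 u2 * v1 + act2 (qt x) u1 u2 * v2 = u1 * act1 x v1 v2 + u2 * act2 x v1 v2"
  by (cases x) (simp add: algebra_simps)

lemma act_qm:
  "[act1 (qm x y) v1 v2 = act1 x (act1 y v1 v2) (act2 y v1 v2)] (mod int p)"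
  "[act2 (qm x y) v1 v2 = act2 x (act1 y v1 v2) (act2 y v1 v2)] (mod int p)"
proof -
  obtain x0 x1 x2 x3 where x: "x = (x0, x1, x2, x3)" by (cases x)
  obtain y0 y1 y2 y3 where y: "y = (y0, y1, y2, y3)" by (cases y)
  \<comment> \<open>Only products among M(j) and M(k) involve a^2 + b^2. The equal factors give the
    coefficient \<open>x2*y2 + x3*y3\<close>, the mixed ones \<open>x2*y3 - x3*y2\<close>.\<close>
  have "act1 x (act1 y v1 v2) (act2 y v1 v2) - act1 (qm x y) v1 v2 =
      (a\<^sup>2 + b\<^sup>2 + 1) * ((x2*y2 + x3*y3) * v1 + (x2*y3 - x3*y2) * v2)"
    by (simp add: x y algebra_simps power2_eq_square)
  moreover have "act2 x (act1 y v1 v2) (act2 y v1 v2) - act2 (qm x y) v1 v2 =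
      (a\<^sup>2 + b\<^sup>2 + 1) * ((x2*y2 + x3*y3) * v2 - (x2*y3 - x3*y2) * v1)"
    by (simp add: x y algebra_simps power2_eq_square)
  ultimately show "[act1 (qm x y) v1 v2 = act1 x (act1 y v1 v2) (act2 y v1 v2)] (mod int p)"
    "[act2 (qm x y) v1 v2 = act2 x (act1 y v1 v2) (act2 y v1 v2)] (mod int p)"
    using ab by (metis cong_iff_dvd_diff cong_sym dvd_mult2)+
qed

lemma act_inverse:
  assumes "x \<in> Q8"
  shows "[act1 x (act1 (qc x) v1 v2) (act2 (qc x) v1 v2) = v1] (mod int p)"
    "[act2 x (act1 (qc x) v1 v2) (act2 (qc x) v1 v2) = v2] (mod int p)"
  using act_qm[of x "qc x" v1 v2] assms by (simp_all add: qm_qc cong_sym)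

lemma mult_el:
  "el x u1 u2 v1 v2 z \<otimes>\<^bsub>G\<^esub> el x' u1' u2' v1' v2' z' =
     el (qm x x')
       (chi x * u1' + act1 (qt x') u1 u2) (chi x * u2' + act2 (qt x') u1 u2)
       (act1 x v1' v2' + v1) (act2 x v1' v2' + v2)
       (chi x * z' + (u1 * v1' + u2 * v2') + z)"
proof -
  have m: "[w mod int p = w] (mod int p)" for w by simp
  have "el x u1 u2 v1 v2 z \<otimes>\<^bsub>G\<^esub> el x' u1' u2' v1' v2' z' =
    el (qm x x')
       (chi x * (u1' mod int p) + act1 (qt x') (u1 mod int p) (u2 mod int p))
       (chi x * (u2' mod int p) + act2 (qt x') (u1 mod int p) (u2 mod int p))
       (act1 x (v1' mod int p) (v2' mod int p) + v1 mod int p) (act2 x (v1' mod int p) (v2' mod int p) + v2 mod int p)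
       (chi x * (z' mod int p) + ((u1 mod int p) * (v1' mod int p) + (u2 mod int p) * (v2' mod int p)) + z mod int p)"
    by (simp add: G_def mulG_def el_def[of x u1] el_def[of x' u1'])
  also have "\<dots> = el (qm x x')
       (chi x * u1' + act1 (qt x') u1 u2) (chi x * u2' + act2 (qt x') u1 u2)
       (act1 x v1' v2' + v1) (act2 x v1' v2' + v2)
       (chi x * z' + (u1 * v1' + u2 * v2') + z)"
    unfolding el_eq_iff by (intro conjI refl cong_add cong_mult cong_refl m act_cong)
  finally show ?thesis .
qed

declare qm.simps [simp del] qc.simps [simp del] qt.simps [simp del] chi.simps [simp del]
  act1.simps [simp del] act2.simps [simp del]

lemma one_simps [simp]: "qt q1 = q1" "chi q1 = 1" "qc q1 = q1" "act1 q1 v1 v2 = v1" "act2 q1 v1 v2 = v2"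
  "q1 \<in> Q8" "q1 \<in> C4" "q1 \<in> C2"
  by (simp_all add: qt.simps chi.simps qc.simps act1.simps act2.simps Q8_def C4_def C2_def)

text \<open>Inverse of a block triangular matrix: the row becomes -chi(x) u^T M(x)^{-1}, the column
  -M(x)^{-1} v and the corner -chi(x) (z - u^T M(x)^{-1} v), as chi(x) is its own inverse.\<close>

lemma left_inverse_el:
  assumes x: "x \<in> Q8"
  shows "el (qc x)
      (- chi x * act1 (qc (qt x)) u1 u2) (- chi x * act2 (qc (qt x)) u1 u2)
      (- act1 (qc x) v1 v2) (- act2 (qc x) v1 v2)
      (- chi x * (z + - (act1 (qc (qt x)) u1 u2 * v1 + act2 (qc (qt x)) u1 u2 * v2)))
    \<otimes>\<^bsub>G\<^esub> el x u1 u2 v1 v2 z = \<one>\<^bsub>G\<^esub>"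
  unfolding mult_el one_G el_eq_iff chi_qc
proof (intro conjI)
  have scal: "act1 y (- (chi x * r1)) (- (chi x * r2)) = - (chi x * act1 y r1 r2)"
    "act2 y (- (chi x * r1)) (- (chi x * r2)) = - (chi x * act2 y r1 r2)" for y r1 r2
    using act_scale[of y "- chi x" r1 r2] by simp_all
  note i = act_inverse[OF qt_Q8[OF x], of u1 u2]
  have "[chi x * u1 + - chi x * act1 (qt x) (act1 (qc (qt x)) u1 u2) (act2 (qc (qt x)) u1 u2) = chi x * u1 + - chi x * u1] (mod int p)"
    by (intro cong_add cong_mult cong_refl i)
  thus "[chi x * u1 + act1 (qt x) (- chi x * act1 (qc (qt x)) u1 u2) (- chi x * act2 (qc (qt x)) u1 u2) = 0] (mod int p)"
    by (simp add: scal)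
  have "[chi x * u2 + - chi x * act2 (qt x) (act1 (qc (qt x)) u1 u2) (act2 (qc (qt x)) u1 u2) = chi x * u2 + - chi x * u2] (mod int p)"
    by (intro cong_add cong_mult cong_refl i)
  thus "[chi x * u2 + act2 (qt x) (- chi x * act1 (qc (qt x)) u1 u2) (- chi x * act2 (qc (qt x)) u1 u2) = 0] (mod int p)"
    by (simp add: scal)
qed (simp_all add: qm_qc x algebra_simps)

lemma group_G: "group G"
proof (rule groupI)
  show "\<one>\<^bsub>G\<^esub> \<in> carrier G" by (simp add: one_G Q8_def)
next
  fix g h assume "g \<in> carrier G" "h \<in> carrier G"
  thus "g \<otimes>\<^bsub>G\<^esub> h \<in> carrier G"
    unfolding carrier_G by (elim elts_cases) (simp add: mult_el qm_Q8)
next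
  fix g h k assume "g \<in> carrier G" "h \<in> carrier G" "k \<in> carrier G"
  then obtain x u1 u2 v1 v2 z y r1 r2 s1 s2 t w l1 l2 m1 m2 n
    where Q: "x \<in> Q8" "y \<in> Q8" "w \<in> Q8"
      and g: "g = el x u1 u2 v1 v2 z" and h: "h = el y r1 r2 s1 s2 t" and k: "k = el w l1 l2 m1 m2 n"
    unfolding carrier_G by (elim elts_cases) blast
  show "g \<otimes>\<^bsub>G\<^esub> h \<otimes>\<^bsub>G\<^esub> k = g \<otimes>\<^bsub>G\<^esub> (h \<otimes>\<^bsub>G\<^esub> k)"
    unfolding g h k mult_el el_eq_iff
  proof (intro conjI)
    have scal: "act1 (qt w) (chi x * r1 + act1 (qt y) u1 u2) (chi x * r2 + act2 (qt y) u1 u2)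
        = chi x * act1 (qt w) r1 r2 + act1 (qt w) (act1 (qt y) u1 u2) (act2 (qt y) u1 u2)"
      "act2 (qt w) (chi x * r1 + act1 (qt y) u1 u2) (chi x * r2 + act2 (qt y) u1 u2)
        = chi x * act2 (qt w) r1 r2 + act2 (qt w) (act1 (qt y) u1 u2) (act2 (qt y) u1 u2)"
      by (simp_all add: act_add act_scale)
    show "[chi (qm x y) * l1 + act1 (qt w) (chi x * r1 + act1 (qt y) u1 u2) (chi x * r2 + act2 (qt y) u1 u2) =
           chi x * (chi y * l1 + act1 (qt w) r1 r2) + act1 (qt (qm y w)) u1 u2] (mod int p)"
      using act_qm(1)[of "qt w" "qt y" u1 u2] unfolding scal qt_qm
      by (simp add: Q chi_qm algebra_simps cong_sym cong_add_lcancel)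
    show "[chi (qm x y) * l2 + act2 (qt w) (chi x * r1 + act1 (qt y) u1 u2) (chi x * r2 + act2 (qt y) u1 u2) =
           chi x * (chi y * l2 + act2 (qt w) r1 r2) + act2 (qt (qm y w)) u1 u2] (mod int p)"
      using act_qm(2)[of "qt w" "qt y" u1 u2] unfolding scal qt_qm
      by (simp add: Q chi_qm algebra_simps cong_sym cong_add_lcancel)
    show "[act1 (qm x y) m1 m2 + (act1 x s1 s2 + v1) = act1 x (act1 y m1 m2 + s1) (act2 y m1 m2 + s2) + v1] (mod int p)"
      "[act2 (qm x y) m1 m2 + (act2 x s1 s2 + v2) = act2 x (act1 y m1 m2 + s1) (act2 y m1 m2 + s2) + v2] (mod int p)"
      using act_qm[of x y m1 m2] by (simp_all add: act_add cong_add_rcancel flip: add.assoc)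
    \<comment> \<open>The one point of associativity in the corner entry: u^T M(y) m is the same
      whether M(y) is applied to the row or to the column.\<close>
    have "act1 (qt y) u1 u2 * m1 + act2 (qt y) u1 u2 * m2 = u1 * act1 y m1 m2 + u2 * act2 y m1 m2"
      by (rule act_adjoint)
    hence "chi (qm x y) * n + ((chi x * r1 + act1 (qt y) u1 u2) * m1 + (chi x * r2 + act2 (qt y) u1 u2) * m2) +
        (chi x * t + (u1 * s1 + u2 * s2) + z) =
      chi x * (chi y * n + (r1 * m1 + r2 * m2) + t) + (u1 * (act1 y m1 m2 + s1) + u2 * (act2 y m1 m2 + s2)) + z"
      by (simp add: Q chi_qm algebra_simps)
    thus "[chi (qm x y) * n + ((chi x * r1 + act1 (qt y) u1 u2) * m1 + (chi x * r2 + act2 (qt y) u1 u2) * m2) +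
        (chi x * t + (u1 * s1 + u2 * s2) + z) =
      chi x * (chi y * n + (r1 * m1 + r2 * m2) + t) + (u1 * (act1 y m1 m2 + s1) + u2 * (act2 y m1 m2 + s2)) + z] (mod int p)"
      by (simp only: cong_refl)
  qed (rule qm_assoc)
next
  fix g assume "g \<in> carrier G"
  thus "\<one>\<^bsub>G\<^esub> \<otimes>\<^bsub>G\<^esub> g = g"
    unfolding carrier_G by (elim elts_cases) (simp add: one_G mult_el)
next
  fix g assume "g \<in> carrier G"
  then obtain x u1 u2 v1 v2 z where x: "x \<in> Q8" and g: "g = el x u1 u2 v1 v2 z"
    unfolding carrier_G by (elim elts_cases)
  show "\<exists>h\<in>carrier G. h \<otimes>\<^bsub>G\<^esub> g = \<one>\<^bsub>G\<^esub>"
    unfolding g by (rule bexI, rule left_inverse_el[OF x]) (simp add: qc_Q8 x)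
qed

sublocale group G by (rule group_G)


section \<open>Orders, subgroups and normal subgroups\<close>

lemma p_pos: "int p > 0" using odd_p by simp

lemma conj_eqI:
  assumes "g \<otimes>\<^bsub>G\<^esub> h = h' \<otimes>\<^bsub>G\<^esub> g" "g \<in> carrier G" "h' \<in> carrier G"
  shows "g \<otimes>\<^bsub>G\<^esub> h \<otimes>\<^bsub>G\<^esub> inv\<^bsub>G\<^esub> g = h'"
  using assms by (metis inv_solve_right' m_closed)

text \<open>Passing to residues presents \<open>elts\<close> as the image of a finite box on which
  the parametrisation is injective; finiteness and cardinalities are read off from it.\<close>

lemma elts_image: "elts A J = (\<lambda>(x, u1, u2, v1, v2, z). el x u1 u2 v1 v2 z) `
    (A \<times> ({0..<int p} \<inter> (\<lambda>t. t mod int p) ` J) \<times> ({0..<int p} \<inter> (\<lambda>t. t mod int p) ` J) \<times> {0..<int p} \<times> {0..<int p} \<times> {0..<int p})"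
  (is "_ = ?f ` ?A")
proof
  show "elts A J \<subseteq> ?f ` ?A"
  proof
    fix g assume "g \<in> elts A J"
    then obtain x u1 u2 v1 v2 z where *: "x \<in> A" "u1 \<in> J" "u2 \<in> J" "g = el x u1 u2 v1 v2 z" by (elim elts_cases)
    have "g = ?f (x, u1 mod int p, u2 mod int p, v1 mod int p, v2 mod int p, z mod int p)"
      by (simp add: * el_eq_iff)
    moreover have "(x, u1 mod int p, u2 mod int p, v1 mod int p, v2 mod int p, z mod int p) \<in> ?A"
      using * p_pos by auto
    ultimately show "g \<in> ?f ` ?A" by (rule image_eqI)
  qed
next
  show "?f ` ?A \<subseteq> elts A J"
  proof
    fix g assume "g \<in> ?f ` ?A"
    then obtain x u1 u2 v1 v2 z where *: "x \<in> A" "u1 \<in> J" "u2 \<in> J"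
      "g = el x (u1 mod int p) (u2 mod int p) v1 v2 z" by auto
    have "g = el x u1 u2 v1 v2 z" by (simp add: * el_eq_iff)
    thus "g \<in> elts A J" using * by simp
  qed
qed

lemma card_elts:
  assumes "J = UNIV \<and> c = p ^ 2 \<or> J = {0} \<and> c = 1"
  shows "card (elts A J) = card A * c * p ^ 3"
proof -
  have U0: "(UNIV :: int set) \<noteq> {0}" by (metis UNIV_I singletonD zero_neq_one)
  have J: "{0..<int p} \<inter> (\<lambda>t. t mod int p) ` J = (if J = UNIV then {0..<int p} else {0})"
  proof (cases "J = UNIV")
    case True
    have "t \<in> range (\<lambda>t. t mod int p)" if "t \<in> {0..<int p}" for t
      using that by (intro range_eqI[of _ _ t]) simp
    thus ?thesis using True by auto
  qed (use assms p_pos in auto)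
  have "card (elts A J) = card (A \<times> (if J = UNIV then {0..<int p} else {0}) \<times> (if J = UNIV then {0..<int p} else {0})
      \<times> {0..<int p} \<times> {0..<int p} \<times> {0..<int p})"
    unfolding elts_image J
  proof (rule card_image, rule inj_onI)
    fix s t :: "quat \<times> int \<times> int \<times> int \<times> int \<times> int"
    let ?A = "A \<times> (if J = UNIV then {0..<int p} else {0}) \<times> (if J = UNIV then {0..<int p} else {0})
      \<times> {0..<int p} \<times> {0..<int p} \<times> {0..<int p}"
    assume s: "s \<in> ?A" and t: "t \<in> ?A"
      and eq: "(case s of (x, u1, u2, v1, v2, z) \<Rightarrow> el x u1 u2 v1 v2 z) = (case t of (x, u1, u2, v1, v2, z) \<Rightarrow> el x u1 u2 v1 v2 z)"
    obtain x u1 u2 v1 v2 z where s': "s = (x, u1, u2, v1, v2, z)" by (cases s)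
    obtain y r1 r2 s1 s2 w where t': "t = (y, r1, r2, s1, s2, w)" by (cases t)
    show "s = t" using s t eq unfolding s' t'
      by (auto simp: el_eq_iff cong_def split: if_splits)
  qed
  also have "\<dots> = card A * c * p ^ 3"
    using assms U0 by (auto simp: card_cartesian_product power2_eq_square power3_eq_cube)
  finally show ?thesis .
qed

lemma finite_G: "finite (carrier G)"
proof -
  have "finite Q8" by (simp add: Q8_def)
  thus ?thesis unfolding carrier_G elts_image by (intro finite_imageI finite_cartesian_product) auto
qed

lemma order_G: "order G = 8 * p ^ 5"
proof -
  have "card Q8 = 8" by (simp add: Q8_def)
  thus ?thesis using card_elts[of UNIV "p ^ 2" Q8] by (simp add: order_def flip: power_add)
qed

lemma inv_el:
  assumes "x \<in> Q8"
  shows "inv\<^bsub>G\<^esub> el x u1 u2 v1 v2 z = el (qc x)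
      (- chi x * act1 (qc (qt x)) u1 u2) (- chi x * act2 (qc (qt x)) u1 u2)
      (- act1 (qc x) v1 v2) (- act2 (qc x) v1 v2)
      (- chi x * (z + - (act1 (qc (qt x)) u1 u2 * v1 + act2 (qc (qt x)) u1 u2 * v2)))"
  by (rule inv_equality[OF left_inverse_el[OF assms]]) (use assms in \<open>simp_all add: qc_Q8\<close>)

lemma subgroup_elts:
  assumes A: "A \<subseteq> Q8" "q1 \<in> A" "\<And>x y. x \<in> A \<Longrightarrow> y \<in> A \<Longrightarrow> qm x y \<in> A" "\<And>x. x \<in> A \<Longrightarrow> qc x \<in> A"
    and J: "J = UNIV \<or> J = {0}"
  shows "subgroup (elts A J) G"
proof (rule subgroupI)
  show "elts A J \<subseteq> carrier G"
    using A(1) unfolding carrier_G by (intro subsetI) (auto elim!: elts_cases intro!: el_in_elts simp del: split_paired_All)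
  have "el q1 0 0 0 0 0 \<in> elts A J" using A J by auto
  thus "elts A J \<noteq> {}" by blast
next
  fix g h assume "g \<in> elts A J" "h \<in> elts A J"
  thus "g \<otimes>\<^bsub>G\<^esub> h \<in> elts A J"
    using J A(3) by (elim elts_cases) (auto simp: mult_el intro!: el_in_elts)
next
  fix g assume "g \<in> elts A J"
  thus "inv\<^bsub>G\<^esub> g \<in> elts A J"
    using J A(1,4) by (elim elts_cases) (auto simp: inv_el subset_iff intro!: el_in_elts)
qed

text \<open>The projection homomorphism onto Q8. The quaternion is stored unreduced, so decoding
  recovers it exactly.\<close>

definition qpart :: "nat \<Rightarrow> quat" where "qpart g = fst (from_nat g :: quat \<times> int \<times> int \<times> int \<times> int \<times> int)"

lemma qpart_el [simp]: "qpart (el x u1 u2 v1 v2 z) = x"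
  by (simp add: qpart_def el_def)

lemma mem_elts_UNIV: "g \<in> elts Q8 UNIV \<Longrightarrow> A \<subseteq> Q8 \<Longrightarrow> g \<in> elts A UNIV \<longleftrightarrow> qpart g \<in> A"
  by (metis UNIV_I elts_cases el_in_elts qpart_el)

lemma qpart_Q8: "g \<in> carrier G \<Longrightarrow> qpart g \<in> Q8"
  unfolding carrier_G by (elim elts_cases) simp

lemma qpart_mult: "g \<in> carrier G \<Longrightarrow> h \<in> carrier G \<Longrightarrow> qpart (g \<otimes>\<^bsub>G\<^esub> h) = qm (qpart g) (qpart h)"
  unfolding carrier_G by (elim elts_cases) (simp add: mult_el)

lemma qpart_inv: "g \<in> carrier G \<Longrightarrow> qpart (inv\<^bsub>G\<^esub> g) = qc (qpart g)"
  unfolding carrier_G by (elim elts_cases) (simp add: inv_el)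

lemma normal_elts_UNIV:
  assumes A: "subgroup (elts A UNIV) G" "A \<subseteq> Q8" "\<And>x y. x \<in> Q8 \<Longrightarrow> y \<in> A \<Longrightarrow> qm (qm x y) (qc x) \<in> A"
  shows "elts A UNIV \<lhd> G"
  unfolding normal_inv_iff
proof (intro conjI ballI A(1))
  fix g h assume g: "g \<in> carrier G" and h: "h \<in> elts A UNIV"
  have hG: "h \<in> carrier G" using h A(1) subgroup.mem_carrier by metis
  have "qpart h \<in> A" using h A(2) hG by (simp add: mem_elts_UNIV)
  hence "qpart (g \<otimes>\<^bsub>G\<^esub> h \<otimes>\<^bsub>G\<^esub> inv\<^bsub>G\<^esub> g) \<in> A"
    using g hG A(3) by (simp add: qpart_mult qpart_inv qpart_Q8 del: carrier_G)
  moreover have "g \<otimes>\<^bsub>G\<^esub> h \<otimes>\<^bsub>G\<^esub> inv\<^bsub>G\<^esub> g \<in> elts Q8 UNIV" using g hG carrier_G by blast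
  ultimately show "g \<otimes>\<^bsub>G\<^esub> h \<otimes>\<^bsub>G\<^esub> inv\<^bsub>G\<^esub> g \<in> elts A UNIV" using mem_elts_UNIV A(2) by blast
qed

lemma Q8_subsets:
  shows "A \<in> {{q1}, C2, C4, Q8} \<Longrightarrow> A \<subseteq> Q8"
    and "A \<in> {{q1}, C2, C4, Q8} \<Longrightarrow> q1 \<in> A"
    and "A \<in> {{q1}, C2, C4, Q8} \<Longrightarrow> x \<in> A \<Longrightarrow> y \<in> A \<Longrightarrow> qm x y \<in> A"
    and "A \<in> {{q1}, C2, C4, Q8} \<Longrightarrow> x \<in> A \<Longrightarrow> qc x \<in> A"
    and "A \<in> {{q1}, C2, C4, Q8} \<Longrightarrow> x \<in> Q8 \<Longrightarrow> y \<in> A \<Longrightarrow> qm (qm x y) (qc x) \<in> A"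
proof -
  show "A \<in> {{q1}, C2, C4, Q8} \<Longrightarrow> A \<subseteq> Q8" "A \<in> {{q1}, C2, C4, Q8} \<Longrightarrow> q1 \<in> A"
    using C2_C4 C4_Q8 by auto
  have *: "x \<in> C2 \<Longrightarrow> y \<in> C2 \<Longrightarrow> qm x y \<in> C2" "x \<in> C4 \<Longrightarrow> y \<in> C4 \<Longrightarrow> qm x y \<in> C4"
    "x \<in> C2 \<Longrightarrow> qc x \<in> C2" "x \<in> C4 \<Longrightarrow> qc x \<in> C4"
    "x \<in> Q8 \<Longrightarrow> y \<in> C2 \<Longrightarrow> qm (qm x y) (qc x) \<in> C2" "x \<in> Q8 \<Longrightarrow> y \<in> C4 \<Longrightarrow> qm (qm x y) (qc x) \<in> C4" for x y
    unfolding C2_def C4_def Q8_def by (auto simp: qm.simps qc.simps)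
  show "A \<in> {{q1}, C2, C4, Q8} \<Longrightarrow> x \<in> A \<Longrightarrow> y \<in> A \<Longrightarrow> qm x y \<in> A"
    "A \<in> {{q1}, C2, C4, Q8} \<Longrightarrow> x \<in> A \<Longrightarrow> qc x \<in> A"
    "A \<in> {{q1}, C2, C4, Q8} \<Longrightarrow> x \<in> Q8 \<Longrightarrow> y \<in> A \<Longrightarrow> qm (qm x y) (qc x) \<in> A"
    by (auto simp: * qm_Q8 qc_Q8 qm_qc)
qed

lemma subgroup_elts': "A \<in> {{q1}, C2, C4, Q8} \<Longrightarrow> J \<in> {UNIV, {0}} \<Longrightarrow> subgroup (elts A J) G"
  by (rule subgroup_elts[OF Q8_subsets(1-4)]) auto

lemma normal_elts: "A \<in> {{q1}, C2, C4, Q8} \<Longrightarrow> elts A UNIV \<lhd> G"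
  by (rule normal_elts_UNIV[OF subgroup_elts' Q8_subsets(1) Q8_subsets(5)]) auto

text \<open>The source of all stabiliser computations on N: x acts on v by M(x) and on z by
  \<open>chi x\<close>, while u adds the pairing of u with the vector part to the central
  entry.\<close>

lemma conj_el:
  assumes x: "x \<in> Q8"
  shows "el x u1 u2 v1 v2 z \<otimes>\<^bsub>G\<^esub> el q1 0 0 w1 w2 t \<otimes>\<^bsub>G\<^esub> inv\<^bsub>G\<^esub> el x u1 u2 v1 v2 z =
    el q1 0 0 (act1 x w1 w2) (act2 x w1 w2) (chi x * t + (u1 * w1 + u2 * w2))"
proof -
  have "el x u1 u2 v1 v2 z \<otimes>\<^bsub>G\<^esub> el q1 0 0 w1 w2 t =
    el q1 0 0 (act1 x w1 w2) (act2 x w1 w2) (chi x * t + (u1 * w1 + u2 * w2)) \<otimes>\<^bsub>G\<^esub> el x u1 u2 v1 v2 z"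
    by (simp add: mult_el algebra_simps)
  thus ?thesis by (rule conj_eqI) (use x in simp_all)
qed

lemma normal_N: "elts {q1} {0} \<lhd> G"
  unfolding normal_inv_iff
proof (intro conjI ballI)
  fix g h assume "g \<in> carrier G" "h \<in> elts {q1} {0}"
  thus "g \<otimes>\<^bsub>G\<^esub> h \<otimes>\<^bsub>G\<^esub> inv\<^bsub>G\<^esub> g \<in> elts {q1} {0}"
    unfolding carrier_G by (elim elts_cases) (simp add: conj_el)
qed (rule subgroup_elts', simp_all)

end

section \<open>Derived length and Fitting height\<close>

context q8_heisenberg
begin

definition Zc :: "nat set" where "Zc = range (el q1 0 0 0 0)"

lemma Zc_el [simp]: "el q1 0 0 0 0 z \<in> Zc"
  by (simp add: Zc_def)

lemma el_q1_in_G [simp]: "el q1 u1 u2 v1 v2 z \<in> carrier G"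
  by simp

lemma subgroup_Zc: "subgroup Zc G"
proof (rule subgroupI)
  show "inv\<^bsub>G\<^esub> g \<in> Zc" if "g \<in> Zc" for g
    using that by (auto simp: Zc_def inv_el)
qed (auto simp: Zc_def mult_el)

lemma normal_Zc: "Zc \<lhd> G"
  unfolding normal_inv_iff
proof (intro conjI ballI subgroup_Zc)
  fix g h assume "g \<in> carrier G" "h \<in> Zc"
  thus "g \<otimes>\<^bsub>G\<^esub> h \<otimes>\<^bsub>G\<^esub> inv\<^bsub>G\<^esub> g \<in> Zc"
    unfolding carrier_G Zc_def by (elim elts_cases) (auto simp: conj_el)
qed

text \<open>The central entry is the symplectic form of the two vector parts, u.s - r.v.\<close>

lemma commutator_P:
  assumes "g \<in> elts {q1} UNIV" "h \<in> elts {q1} UNIV"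
  shows "g \<otimes>\<^bsub>G\<^esub> h \<otimes>\<^bsub>G\<^esub> inv\<^bsub>G\<^esub> g \<otimes>\<^bsub>G\<^esub> inv\<^bsub>G\<^esub> h \<in> Zc"
proof -
  obtain u1 u2 v1 v2 z where g: "g = el q1 u1 u2 v1 v2 z" using assms(1) by (elim elts_cases) auto
  obtain r1 r2 s1 s2 t where h: "h = el q1 r1 r2 s1 s2 t" using assms(2) by (elim elts_cases) auto
  have "el q1 0 0 0 0 (u1 * s1 + u2 * s2 - (r1 * v1 + r2 * v2)) \<otimes>\<^bsub>G\<^esub> (h \<otimes>\<^bsub>G\<^esub> g) = g \<otimes>\<^bsub>G\<^esub> h"
    by (simp add: g h mult_el algebra_simps)
  hence "g \<otimes>\<^bsub>G\<^esub> h \<otimes>\<^bsub>G\<^esub> inv\<^bsub>G\<^esub> g \<otimes>\<^bsub>G\<^esub> inv\<^bsub>G\<^esub> h = el q1 0 0 0 0 (u1 * s1 + u2 * s2 - (r1 * v1 + r2 * v2))"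
    by (rule commutator_eqI) (simp_all add: g h)
  thus ?thesis by simp
qed

lemma commutator_Zc:
  assumes "g \<in> Zc" "h \<in> elts {q1} UNIV"
  shows "g \<otimes>\<^bsub>G\<^esub> h \<otimes>\<^bsub>G\<^esub> inv\<^bsub>G\<^esub> g \<otimes>\<^bsub>G\<^esub> inv\<^bsub>G\<^esub> h = \<one>\<^bsub>G\<^esub>"
proof -
  obtain z where g: "g = el q1 0 0 0 0 z" using assms(1) by (auto simp: Zc_def)
  obtain r1 r2 s1 s2 t where h: "h = el q1 r1 r2 s1 s2 t" using assms(2) by (elim elts_cases) auto
  have "\<one>\<^bsub>G\<^esub> \<otimes>\<^bsub>G\<^esub> (h \<otimes>\<^bsub>G\<^esub> g) = g \<otimes>\<^bsub>G\<^esub> h"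
    by (simp add: one_G g h mult_el algebra_simps)
  thus ?thesis by (rule commutator_eqI) (simp_all add: g h one_G)
qed

lemma qpart_commutator:
  assumes "g \<in> carrier G" "h \<in> carrier G"
  shows "qpart (g \<otimes>\<^bsub>G\<^esub> h \<otimes>\<^bsub>G\<^esub> inv\<^bsub>G\<^esub> g \<otimes>\<^bsub>G\<^esub> inv\<^bsub>G\<^esub> h) = qm (qm (qpart g) (qpart h)) (qm (qc (qpart g)) (qc (qpart h)))"
  using assms by (simp add: qpart_mult qpart_inv qm_assoc del: carrier_G)

lemma commutator_in_elts:
  assumes "g \<in> carrier G" "h \<in> carrier G" "A \<subseteq> Q8"
    "qm (qm (qpart g) (qpart h)) (qm (qc (qpart g)) (qc (qpart h))) \<in> A"
  shows "g \<otimes>\<^bsub>G\<^esub> h \<otimes>\<^bsub>G\<^esub> inv\<^bsub>G\<^esub> g \<otimes>\<^bsub>G\<^esub> inv\<^bsub>G\<^esub> h \<in> elts A UNIV"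
proof -
  have "g \<otimes>\<^bsub>G\<^esub> h \<otimes>\<^bsub>G\<^esub> inv\<^bsub>G\<^esub> g \<otimes>\<^bsub>G\<^esub> inv\<^bsub>G\<^esub> h \<in> carrier G" using assms(1,2) by blast
  thus ?thesis using assms qpart_commutator mem_elts_UNIV by simp
qed

lemma commutator_G:
  assumes "g \<in> carrier G" "h \<in> carrier G"
  shows "g \<otimes>\<^bsub>G\<^esub> h \<otimes>\<^bsub>G\<^esub> inv\<^bsub>G\<^esub> g \<otimes>\<^bsub>G\<^esub> inv\<^bsub>G\<^esub> h \<in> elts C2 UNIV"
  using assms by (intro commutator_in_elts commutator_Q8 qpart_Q8) (use Q8_subsets(1)[of C2] in auto)

text \<open>The elements 1 and -1 are central in Q8, so the projection of the commutator is
  trivial.\<close>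

lemma commutator_C2:
  assumes "g \<in> elts C2 UNIV" "h \<in> carrier G"
  shows "g \<otimes>\<^bsub>G\<^esub> h \<otimes>\<^bsub>G\<^esub> inv\<^bsub>G\<^esub> g \<otimes>\<^bsub>G\<^esub> inv\<^bsub>G\<^esub> h \<in> elts {q1} UNIV"
proof -
  have g: "g \<in> carrier G" using assms(1) subgroup.mem_carrier[OF subgroup_elts'[of C2 UNIV]] by simp
  hence "qpart g \<in> C2" using assms(1) mem_elts_UNIV Q8_subsets(1)[of C2] by auto
  moreover have "qm (qm x y) (qm (qc x) (qc y)) = q1" if "x \<in> C2" "y \<in> Q8" for x y
    using that unfolding C2_def Q8_def by (auto simp: qm.simps qc.simps)
  ultimately show ?thesis
    using assms g qpart_Q8 Q8_subsets(1)[of "{q1}"] by (intro commutator_in_elts) auto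
qed

lemma derived_sub:
  "derived G (carrier G) \<subseteq> elts C2 UNIV"
  "derived G (elts C2 UNIV) \<subseteq> elts {q1} UNIV"
  "derived G (elts {q1} UNIV) \<subseteq> Zc"
  "derived G Zc \<subseteq> {\<one>\<^bsub>G\<^esub>}"
  unfolding derived_eq_commutator
proof (rule_tac [!] commutator_subgroup_subset)
  have C2: "elts C2 UNIV \<subseteq> carrier G"
    using subgroup.subset[OF subgroup_elts'[of C2 UNIV]] by simp
  show "g \<otimes>\<^bsub>G\<^esub> h \<otimes>\<^bsub>G\<^esub> inv\<^bsub>G\<^esub> g \<otimes>\<^bsub>G\<^esub> inv\<^bsub>G\<^esub> h \<in> elts {q1} UNIV" if "g \<in> elts C2 UNIV" "h \<in> elts C2 UNIV" for g h
    using that C2 commutator_C2 by blast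
  have "Zc \<subseteq> elts {q1} UNIV" by (auto simp: Zc_def)
  thus "g \<otimes>\<^bsub>G\<^esub> h \<otimes>\<^bsub>G\<^esub> inv\<^bsub>G\<^esub> g \<otimes>\<^bsub>G\<^esub> inv\<^bsub>G\<^esub> h \<in> {\<one>\<^bsub>G\<^esub>}" if "g \<in> Zc" "h \<in> Zc" for g h
    using that commutator_Zc by blast
qed (use commutator_G commutator_P subgroup_Zc triv_subgroup in \<open>auto intro!: subgroup_elts' simp del: carrier_G\<close>)

section \<open>Commutators with -1 and the lower bound for the derived length\<close>

abbreviation "mq \<equiv> ((-1, 0, 0, 0) :: quat)"

lemma mq_simps [simp]: "mq \<in> Q8" "mq \<in> C4" "mq \<in> C2" "qm mq x = (case x of (x0, x1, x2, x3) \<Rightarrow> (-x0, -x1, -x2, -x3))"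
  "chi mq = 1" "qt mq = mq" "act1 mq v1 v2 = - v1" "act2 mq v1 v2 = - v2"
  by (auto simp: Q8_def C4_def C2_def qm.simps chi.simps qt.simps act1.simps act2.simps split: prod.splits)

lemma halving: "\<exists>c. [2 * c = u] (mod int p)"
proof -
  have "odd p" using prime_p odd_p primes_dvd_imp_eq two_is_prime_nat by blast
  then obtain k where k: "p = 2 * k + 1" by (elim oddE)
  \<comment> \<open>\<open>k + 1\<close> inverts 2, because 2 (k + 1) = p + 1.\<close>
  have "2 * (u * (int k + 1)) = u + int p * u" by (simp add: k algebra_simps)
  hence "[2 * (u * (int k + 1)) = u] (mod int p)" by (simp add: cong_iff_dvd_diff)
  thus ?thesis by blast
qed

text \<open>The central involution acts on both copies of W as -1, so its commutator with a vector
  doubles that vector; halving the target first makes every vector a commutator.\<close>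

lemma commutator_mq:
  "[2 * c = u] (mod int p) \<Longrightarrow> g = el q1 c 0 0 0 0 \<Longrightarrow> h = el mq 0 0 0 0 0 \<Longrightarrow>
    g \<otimes>\<^bsub>G\<^esub> h \<otimes>\<^bsub>G\<^esub> inv\<^bsub>G\<^esub> g \<otimes>\<^bsub>G\<^esub> inv\<^bsub>G\<^esub> h = el q1 u 0 0 0 0"
  "[2 * c = u] (mod int p) \<Longrightarrow> g = el q1 0 0 c 0 0 \<Longrightarrow> h = el mq 0 0 0 0 0 \<Longrightarrow>
    g \<otimes>\<^bsub>G\<^esub> h \<otimes>\<^bsub>G\<^esub> inv\<^bsub>G\<^esub> g \<otimes>\<^bsub>G\<^esub> inv\<^bsub>G\<^esub> h = el q1 0 0 u 0 0"
  by (rule commutator_eqI; auto simp: mult_el el_eq_iff cong_iff_dvd_diff algebra_simps dest: cong_sym)+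

lemma derived_contains_mq: "el mq 0 0 0 0 0 \<in> derived G (carrier G)"
proof -
  let ?i = "el (0,1,0,0) 0 0 0 0 0" and ?j = "el (0,0,1,0) 0 0 0 0 0"
  have in_G: "?i \<in> carrier G" "?j \<in> carrier G" "el mq 0 0 0 0 0 \<in> carrier G" by (simp_all add: Q8_def)
  have "?i \<otimes>\<^bsub>G\<^esub> ?j \<otimes>\<^bsub>G\<^esub> inv\<^bsub>G\<^esub> ?i \<otimes>\<^bsub>G\<^esub> inv\<^bsub>G\<^esub> ?j = el mq 0 0 0 0 0"
    by (rule commutator_eqI) (use in_G in \<open>simp_all add: mult_el qm.simps\<close>)
  thus ?thesis using commutator_in[OF in_G(1,2)] by (simp add: derived_eq_commutator del: carrier_G)
qed

text \<open>The hypotheses hold for G and, by \<open>derived_contains_mq\<close>, again for its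
  derived subgroup; the vectors therefore survive two steps.\<close>

lemma derived_contains_vectors:
  assumes "\<And>u. el q1 u 0 0 0 0 \<in> H" "\<And>v. el q1 0 0 v 0 0 \<in> H" "el mq 0 0 0 0 0 \<in> H"
  shows "el q1 u 0 0 0 0 \<in> derived G H" "el q1 0 0 v 0 0 \<in> derived G H"
proof -
  obtain c where c: "[2 * c = u] (mod int p)" using halving by blast
  obtain d where d: "[2 * d = v] (mod int p)" using halving by blast
  show "el q1 u 0 0 0 0 \<in> derived G H"
    using commutator_in[OF assms(1)[of c] assms(3)]
    unfolding derived_eq_commutator commutator_mq(1)[OF c refl refl] .
  show "el q1 0 0 v 0 0 \<in> derived G H"
    using commutator_in[OF assms(2)[of d] assms(3)]
    unfolding derived_eq_commutator commutator_mq(2)[OF d refl refl] .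
qed

text \<open>The second derived subgroup still contains both copies of W, and two dual basis vectors
  have a nontrivial central commutator.\<close>

lemma derived_third_nontrivial: "el q1 0 0 0 0 1 \<in> (derived G ^^ 3) (carrier G)"
proof -
  let ?D = "derived G (carrier G)"
  have 1: "el q1 u 0 0 0 0 \<in> ?D" "el q1 0 0 v 0 0 \<in> ?D" for u v
    by (rule derived_contains_vectors; simp)+
  have 2: "el q1 u 0 0 0 0 \<in> derived G ?D" "el q1 0 0 v 0 0 \<in> derived G ?D" for u v
    by (rule derived_contains_vectors; (rule 1 derived_contains_mq))+
  let ?e = "el q1 1 0 0 0 0" and ?f = "el q1 0 0 1 0 0"
  have "?e \<otimes>\<^bsub>G\<^esub> ?f \<otimes>\<^bsub>G\<^esub> inv\<^bsub>G\<^esub> ?e \<otimes>\<^bsub>G\<^esub> inv\<^bsub>G\<^esub> ?f = el q1 0 0 0 0 1"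
    by (rule commutator_eqI) (simp_all add: mult_el)
  thus ?thesis using commutator_in[OF 2] by (simp add: derived_eq_commutator numeral_3_eq_3 del: carrier_G) metis
qed

lemma el_q1_neq_one: "el q1 0 0 0 0 1 \<noteq> \<one>\<^bsub>G\<^esub>" "el q1 1 0 0 0 0 \<noteq> \<one>\<^bsub>G\<^esub>"
  using odd_p by (auto simp: one_G el_eq_iff cong_def)

lemma derived_fourth: "(derived G ^^ 4) (carrier G) = {\<one>\<^bsub>G\<^esub>}"
proof -
  have mono: "K \<subseteq> H \<Longrightarrow> H \<subseteq> carrier G \<Longrightarrow> derived G K \<subseteq> derived G H" for K H
    by (rule mono_derived)
  have sub: "elts C2 UNIV \<subseteq> carrier G" "elts {q1} UNIV \<subseteq> carrier G" "Zc \<subseteq> carrier G"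
    using subgroup.subset[OF subgroup_elts'] subgroup.subset[OF subgroup_Zc] by simp_all
  have "derived G (derived G (carrier G)) \<subseteq> elts {q1} UNIV"
    using mono[OF derived_sub(1) sub(1)] derived_sub(2) by blast
  hence "derived G (derived G (derived G (carrier G))) \<subseteq> Zc"
    using mono[OF _ sub(2)] derived_sub(3) by blast
  hence "derived G (derived G (derived G (derived G (carrier G)))) \<subseteq> {\<one>\<^bsub>G\<^esub>}"
    using mono[OF _ sub(3)] derived_sub(4) by blast
  moreover have "\<one>\<^bsub>G\<^esub> \<in> derived G H" for H
    unfolding derived_def by (rule generate.one)
  ultimately show ?thesis by (auto simp: numeral_eq_Suc simp del: carrier_G)
qed

lemma solvable_G: "solvable G"
  using solvable_iff_trivial_derived_seq derived_fourth by blast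

lemma derived_length_G: "derived_length G = 4"
  unfolding derived_length_def
proof (rule Least_equality, rule derived_fourth)
  fix n assume n: "(derived G ^^ n) (carrier G) = {\<one>\<^bsub>G\<^esub>}"
  show "4 \<le> n"
  proof (rule ccontr)
    assume "\<not> 4 \<le> n"
    hence "3 = (3 - n) + n" by simp
    hence "(derived G ^^ 3) (carrier G) = (derived G ^^ (3 - n)) ((derived G ^^ n) (carrier G))"
      by (metis comp_apply funpow_add)
    also have "\<dots> \<subseteq> {\<one>\<^bsub>G\<^esub>}"
    proof -
      have "(derived G ^^ k) {\<one>\<^bsub>G\<^esub>} \<subseteq> {\<one>\<^bsub>G\<^esub>}" for k
      proof (induction k)
        case (Suc k)
        show ?case using derived_incl[OF Suc triv_subgroup] by simp
      qed simp
      thus ?thesis unfolding n .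
    qed
    finally show False using derived_third_nontrivial el_q1_neq_one by blast
  qed
qed

section \<open>Lower central series and Fitting height\<close>

lemma lower_central_G: "lower_central G 2 \<subseteq> elts {q1} UNIV"
proof -
  have 1: "lower_central G 1 \<subseteq> elts C2 UNIV"
    unfolding One_nat_def lower_central.simps
    by (rule commutator_subgroup_subset[OF subgroup_elts']) (simp_all only: commutator_G insert_iff simp_thms)
  have "commutator_subgroup G (lower_central G 1) (carrier G) \<subseteq> elts {q1} UNIV"
    by (rule commutator_subgroup_subset[OF subgroup_elts']) (simp_all only: commutator_C2[OF subsetD[OF 1]] insert_iff simp_thms)
  thus ?thesis by (simp add: numeral_2_eq_2 del: carrier_G)
qed

text \<open>A vector is the commutator of its half with -1, so it never leaves the series. This is
  why G is not nilpotent.\<close>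

lemma lower_central_G_nontrivial: "el q1 u 0 0 0 0 \<in> lower_central G n"
proof (induction n arbitrary: u)
  case (Suc n)
  obtain c where "[2 * c = u] (mod int p)" using halving by blast
  moreover have "el mq 0 0 0 0 0 \<in> carrier G" by simp
  ultimately show ?case
    using commutator_in[OF Suc.IH[of c], of "el mq 0 0 0 0 0" "carrier G"] by (simp add: commutator_mq del: carrier_G)
qed simp

lemma nilpotent_P: "nilpotent_group ((G\<lparr>carrier := elts {q1} UNIV\<rparr>) Mod {\<one>\<^bsub>G\<^esub>})"
proof -
  let ?P = "G\<lparr>carrier := elts {q1} UNIV\<rparr>"
  have P: "subgroup (elts {q1} UNIV) G" by (rule subgroup_elts') auto
  interpret P: group ?P by (rule subgroup_imp_group[OF P])
  have inv: "inv\<^bsub>?P\<^esub> g = inv\<^bsub>G\<^esub> g" if "g \<in> elts {q1} UNIV" for g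
    by (rule m_inv_consistent[OF P that])
  have Zs: "subgroup Zc ?P"
    by (rule subgroup_incl[OF subgroup_Zc P]) (auto simp: Zc_def)
  have "lower_central ?P 1 \<subseteq> Zc"
    using P.commutator_subgroup_subset[OF Zs, of "elts {q1} UNIV" "elts {q1} UNIV"] commutator_P by (simp add: inv)
  hence "lower_central ?P 2 \<subseteq> {\<one>\<^bsub>G\<^esub>}"
    using P.commutator_subgroup_subset[OF P.triv_subgroup, of "lower_central ?P 1" "elts {q1} UNIV"]
      commutator_Zc inv subgroup.subset[OF Zs] by (simp add: numeral_2_eq_2 subset_iff)
  thus ?thesis using P.nilpotent_Mod_iff[OF P.one_is_normal] by auto
qed

lemma fitting_height_G: "fitting_height G = 2"
  unfolding fitting_height_def
proof (rule Least_equality)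
  have nil2: "nilpotent_group (G Mod (elts {q1} UNIV))"
    using nilpotent_Mod_iff[OF normal_elts] lower_central_G by auto
  have GG: "G\<lparr>carrier := carrier G\<rparr> = G" by simp
  \<comment> \<open>The chain 1 < P < G, with factors P and Q8, both nilpotent of class 2.\<close>
  let ?N = "\<lambda>i::nat. if i = 0 then {\<one>\<^bsub>G\<^esub>} else if i = 1 then elts {q1} UNIV else carrier G"
  have "?N i \<lhd> G" for i using one_is_normal normal_elts[of "{q1}"] normal_elts[of Q8] by simp
  moreover have "?N i \<subseteq> ?N (Suc i) \<and> nilpotent_group ((G\<lparr>carrier := ?N (Suc i)\<rparr>) Mod (?N i))" if "i < 2" for i
  proof -
    have "elts {q1} UNIV \<subseteq> carrier G" using subgroup.subset[OF subgroup_elts'] by simp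
    moreover have "\<one>\<^bsub>G\<^esub> \<in> elts {q1} UNIV" by (simp add: one_G)
    moreover have "i = 0 \<or> i = 1" using that by auto
    ultimately show ?thesis
    proof (elim disjE)
      assume "i = 0" "\<one>\<^bsub>G\<^esub> \<in> elts {q1} UNIV"
      thus ?thesis using nilpotent_P by simp
    next
      assume "i = 1" "elts {q1} UNIV \<subseteq> carrier G"
      thus ?thesis using nil2 GG by (simp del: carrier_G)
    qed
  qed
  ultimately show "\<exists>N. N 0 = {\<one>\<^bsub>G\<^esub>} \<and> N 2 = carrier G \<and> (\<forall>i\<le>2. N i \<lhd> G) \<and>
      (\<forall>i<2. N i \<subseteq> N (Suc i) \<and> nilpotent_group ((G\<lparr>carrier := N (Suc i)\<rparr>) Mod (N i)))"
    by (intro exI[of _ ?N] conjI allI impI) (blast | simp)+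
next
  fix h assume "\<exists>N. N 0 = {\<one>\<^bsub>G\<^esub>} \<and> N h = carrier G \<and> (\<forall>i\<le>h. N i \<lhd> G) \<and>
      (\<forall>i<h. N i \<subseteq> N (Suc i) \<and> nilpotent_group ((G\<lparr>carrier := N (Suc i)\<rparr>) Mod (N i)))"
  then obtain N where "N 0 = {\<one>\<^bsub>G\<^esub>} \<and> N h = carrier G \<and> (\<forall>i\<le>h. N i \<lhd> G) \<and>
      (\<forall>i<h. N i \<subseteq> N (Suc i) \<and> nilpotent_group ((G\<lparr>carrier := N (Suc i)\<rparr>) Mod (N i)))" by (elim exE)
  hence N: "N 0 = {\<one>\<^bsub>G\<^esub>}" "N h = carrier G"
    "\<forall>i<h. nilpotent_group ((G\<lparr>carrier := N (Suc i)\<rparr>) Mod (N i))" by simp_all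
  show "2 \<le> h"
  \<comment> \<open>Height 0 would make G trivial and height 1 would make G itself
    nilpotent.\<close>
  proof (rule ccontr)
    assume "\<not> 2 \<le> h"
    then consider "h = 0" | "h = 1" by linarith
    thus False
    proof cases
      case 1
      hence "el q1 1 0 0 0 0 \<in> {\<one>\<^bsub>G\<^esub>}" using N el_q1_in_G by metis
      thus False using el_q1_neq_one by simp
    next
      case 2
      hence "nilpotent_group (G Mod {\<one>\<^bsub>G\<^esub>})" using N by (simp del: carrier_G)
      then obtain n where "lower_central G n \<subseteq> {\<one>\<^bsub>G\<^esub>}" using nilpotent_Mod_iff[OF one_is_normal] by blast
      thus False using lower_central_G_nontrivial el_q1_neq_one by blast
    qed
  qed
qed

end

section \<open>Character degrees\<close>

text \<open>Stabiliser conditions are stated with \<open>inv g \<otimes> y \<otimes> g\<close>,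
  whereas \<open>conj_el\<close> computes \<open>g \<otimes> y \<otimes> inv g\<close>; this
  converts between them.\<close>

lemma (in group) conj_invariant:
  assumes N: "N \<lhd> G" and g: "g \<in> carrier G" and y: "y \<in> N"
    and inv: "\<And>y. y \<in> N \<Longrightarrow> \<mu> (inv g \<otimes> y \<otimes> g) = \<mu> y"
  shows "\<mu> (g \<otimes> y \<otimes> inv g) = \<mu> y"
proof -
  have yG: "y \<in> carrier G" by (rule subgroup.mem_carrier[OF normal_imp_subgroup[OF N] y])
  have "inv g \<otimes> (g \<otimes> y \<otimes> inv g) \<otimes> g = y" using g yG by (simp add: m_assoc inv_cancel_left)
  thus ?thesis using inv[OF normal.inv_op_closed2[OF N g y]] by simp
qed

context finite_group_rep
begin

lemma eigenvalue_unique: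
  fixes w :: "complex vec"
  assumes "w \<in> carrier_vec n" "w \<noteq> 0\<^sub>v n" "c \<cdot>\<^sub>v w = d \<cdot>\<^sub>v w"
  shows "c = d"
proof (rule ccontr)
  assume "c \<noteq> d"
  have "w $ i = 0" if "i < n" for i
  proof -
    have "(c \<cdot>\<^sub>v w) $ i = (d \<cdot>\<^sub>v w) $ i" using assms(3) by simp
    thus ?thesis using that assms(1) \<open>c \<noteq> d\<close> by simp
  qed
  hence "w = 0\<^sub>v n" using assms(1) by (intro eq_vecI) auto
  with assms(2) show False ..
qed

text \<open>Comparing scalars on one nonzero vector shows that a weight read off from an eigenvector
  is automatically a linear character.\<close>

lemma eigenvalue_hom:
  assumes T: "subgroup T G" and w: "w \<in> carrier_vec n" "w \<noteq> 0\<^sub>v n" "\<And>t. t \<in> T \<Longrightarrow> \<rho> t *\<^sub>v w = \<mu> t \<cdot>\<^sub>v w"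
  shows "s \<in> T \<Longrightarrow> t \<in> T \<Longrightarrow> \<mu> (s \<otimes> t) = \<mu> s * \<mu> t" and "\<mu> \<one> = 1"
proof -
  assume s: "s \<in> T" and t: "t \<in> T"
  have G: "s \<in> carrier G" "t \<in> carrier G" using s t T subgroup.mem_carrier by metis+
  have "\<mu> (s \<otimes> t) \<cdot>\<^sub>v w = \<rho> (s \<otimes> t) *\<^sub>v w" using w(3) subgroup.m_closed[OF T s t] by simp
  also have "\<dots> = (\<mu> s * \<mu> t) \<cdot>\<^sub>v w"
    using G w s t by (simp add: rho_mult rho_smult smult_smult_assoc mult.commute)
  finally show "\<mu> (s \<otimes> t) = \<mu> s * \<mu> t" by (rule eigenvalue_unique[OF w(1,2)])
next
  have "\<mu> \<one> \<cdot>\<^sub>v w = 1 \<cdot>\<^sub>v w" using w(3)[OF subgroup.one_closed[OF T]] w(1) by (simp add: rho_one)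
  thus "\<mu> \<one> = 1" by (rule eigenvalue_unique[OF w(1,2)])
qed

end

section \<open>Characters of the integers modulo p, as p-periodic functions on the integers\<close>

lemma int_character_mult:
  fixes l :: "int \<Rightarrow> complex"
  assumes add: "\<And>m k. l (m + k) = l m * l k" and zero: "l 0 = 1"
  shows "l (int k * m) = l m ^ k"
  by (induction k) (simp_all add: zero add ring_distribs)

lemma int_character_kernel:
  fixes l :: "int \<Rightarrow> complex"
  assumes p: "Factorial_Ring.prime p" and add: "\<And>m k. l (m + k) = l m * l k" and zero: "l 0 = 1"
    and per: "l (int p) = 1" and nontrivial: "l c \<noteq> 1"
  shows "l m = 1 \<longleftrightarrow> int p dvd m"
proof -
  have mult: "l (k * m) = 1" if "l m = 1" for k m
  proof (cases k rule: int_cases2)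
    case (nonneg j)
    thus ?thesis using that int_character_mult[OF add zero] by simp
  next
    case (nonpos j)
    have "l (int j * m) = 1" using that int_character_mult[OF add zero] by simp
    moreover have "l (k * m) * l (int j * m) = 1" using nonpos by (simp flip: add add: zero)
    ultimately show ?thesis by simp
  qed
  show ?thesis
  proof
    assume m: "l m = 1"
    show "int p dvd m"
    proof (rule ccontr)
      assume "\<not> int p dvd m"
      hence "coprime m (int p)"
        using p prime_imp_coprime[of "int p" m] by (simp add: coprime_commute)
      \<comment> \<open>By Bezout, an m in the kernel that is prime to p would put 1 into the kernel
        and make the character trivial.\<close>
      then obtain s t where "s * m + t * int p = 1" by (metis bezout_int coprime_imp_gcd_eq_1)
      hence "l 1 = 1" using mult[OF m, of s] mult[OF per, of t] add[of "s * m" "t * int p"] by simp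
      from mult[OF this, of c] nontrivial show False by simp
    qed
  next
    assume "int p dvd m"
    thus "l m = 1" using mult[OF per] by (metis dvdE mult.commute)
  qed
qed

text \<open>The kernel is exactly the multiples of p, so the p residues have distinct values; these
  are p-th roots of unity, of which there are only p.\<close>

lemma int_character_roots:
  fixes l :: "int \<Rightarrow> complex"
  assumes p: "Factorial_Ring.prime p" and add: "\<And>m k. l (m + k) = l m * l k" and zero: "l 0 = 1"
    and per: "l (int p) = 1" and nontrivial: "l c \<noteq> 1" and d: "d ^ p = 1"
  shows "\<exists>k. d = l k"
proof -
  have p0: "p > 0" using p prime_gt_0_nat by blast
  have "inj_on (\<lambda>k. l (int k)) {..<p}"
  proof (rule inj_onI)
    fix j k assume jk: "j \<in> {..<p}" "k \<in> {..<p}" and eq: "l (int j) = l (int k)"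
    have "l (int k) * l (- int k) = 1" by (simp flip: add add: zero)
    hence "l (int j - int k) = 1" using add[of "int j" "- int k"] eq by simp
    hence "int p dvd int j - int k" using int_character_kernel[OF p add zero per nontrivial] by simp
    hence "[int j = int k] (mod int p)" by (simp add: cong_iff_dvd_diff)
    thus "j = k" using jk by (simp add: cong_int_iff cong_less_modulus_unique_nat)
  qed
  hence "card ((\<lambda>k. l (int k)) ` {..<p}) = card {z::complex. z ^ p = 1}"
    using p0 by (simp add: card_image card_roots_unity_eq)
  moreover have "(\<lambda>k. l (int k)) ` {..<p} \<subseteq> {z. z ^ p = 1}"
  proof
    fix z assume "z \<in> (\<lambda>k. l (int k)) ` {..<p}"
    then obtain k where k: "z = l (int k)" by blast
    have "z ^ p = l (int p * int k)" unfolding k by (rule int_character_mult[OF add zero, symmetric])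
    also have "\<dots> = l (int p) ^ k" by (simp add: mult.commute int_character_mult[OF add zero])
    finally show "z \<in> {z. z ^ p = 1}" by (simp add: per)
  qed
  ultimately have "(\<lambda>k. l (int k)) ` {..<p} = {z. z ^ p = 1}"
    using p0 by (intro card_subset_eq finite_roots_unity) auto
  thus ?thesis using d by blast
qed

context q8_heisenberg
begin

lemma inverse_2_4: "\<exists>c. [2 * c = 1] (mod int p)" "\<exists>c. [4 * c = 1] (mod int p)"
proof -
  have "odd p" using prime_p odd_p primes_dvd_imp_eq two_is_prime_nat by blast
  hence 2: "coprime 2 (int p)" by simp
  thus "\<exists>c. [2 * c = 1] (mod int p)" by (rule cong_solve_coprime_int)
  from 2 have "coprime (2 * 2) (int p)" unfolding coprime_mult_left_iff by blast
  thus "\<exists>c. [4 * c = 1] (mod int p)" by (intro cong_solve_coprime_int) simp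
qed

text \<open>The determinant of \<open>M(x) - 1\<close> is modulo \<open>p\<close> the norm of \<open>x - 1\<close>, which is 2 or 4.\<close>

lemma act_minus_one_surj:
  assumes x: "x \<in> Q8" "x \<noteq> q1"
  shows "\<exists>v1 v2. [act1 x v1 v2 - v1 = w1] (mod int p) \<and> [act2 x v1 v2 - v2 = w2] (mod int p)"
proof -
  obtain x0 x1 x2 x3 where x': "x = (x0, x1, x2, x3)" by (cases x)
  define N where "N = (x0 - 1)\<^sup>2 + x1\<^sup>2 + x2\<^sup>2 + x3\<^sup>2"
  have "N = 2 \<or> N = 4" using x by (auto simp: Q8_def x' N_def)
  then obtain e where e: "[N * e = 1] (mod int p)" using inverse_2_4 by auto
  define A where "A = x0 - 1 + a*x2 - b*x3"
  define B where "B = - x1 + b*x2 + a*x3"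
  define C where "C = x1 + b*x2 + a*x3"
  define D where "D = x0 - 1 - a*x2 + b*x3"
  have "N - (A * D - B * C) = (a\<^sup>2 + b\<^sup>2 + 1) * (x2\<^sup>2 + x3\<^sup>2)"
    by (simp add: N_def A_def B_def C_def D_def power2_eq_square algebra_simps)
  hence "[A * D - B * C = N] (mod int p)" using ab by (metis cong_iff_dvd_diff cong_sym dvd_mult2)
  hence "[(A * D - B * C) * e = N * e] (mod int p)" by (intro cong_mult cong_refl)
  with e have det: "[(A * D - B * C) * e = 1] (mod int p)" by (rule cong_trans[rotated])
  \<comment> \<open>Cramer's rule: the adjugate of M(x) - 1 applied to (w1, w2), times the inverse
    \<open>e\<close> of the determinant.\<close>
  define v1 where "v1 = e * (D * w1 - B * w2)"
  define v2 where "v2 = e * (A * w2 - C * w1)"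
  have "act1 x v1 v2 - v1 = (A * D - B * C) * e * w1"
    by (simp add: x' act1.simps v1_def v2_def A_def B_def C_def D_def algebra_simps)
  moreover have "act2 x v1 v2 - v2 = (A * D - B * C) * e * w2"
    by (simp add: x' act2.simps v1_def v2_def A_def B_def C_def D_def algebra_simps)
  moreover have "[(A * D - B * C) * e * w = w] (mod int p)" for w
    using cong_mult[OF det cong_refl[of w]] by simp
  ultimately show ?thesis by metis
qed

section \<open>Representations of degrees 1, 2, 8 and 2 p^2\<close>

lemma one_in_char_degrees: "1 \<in> char_degrees G"
proof -
  have "order G div card (carrier G) \<in> char_degrees G"
    by (rule induced_irreducible_rep[OF finite_G subgroup_self _ subset_refl, where \<mu> = "\<lambda>_. 1"])
      (use normal_elts[of Q8] in simp_all)
  moreover have "card (carrier G) > 0" using order_G odd_p by (simp add: order_def)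
  ultimately show ?thesis by (simp add: order_def del: carrier_G)
qed

lemma card_elts_UNIV: "card (elts A UNIV) = card A * p ^ 5"
  using card_elts[of UNIV "p ^ 2" A] by (simp add: flip: power_add)

lemma card_C: "card C4 = 4" "card {q1} = 1"
  by (simp_all add: C4_def)

text \<open>Induced from the faithful character of C4, inflated to P C4: the quaternion x0 + x1 i is
  read as a complex number. Elements outside C4 conjugate i to -i and so do not fix it.\<close>

lemma two_in_char_degrees: "2 \<in> char_degrees G"
proof -
  define \<mu> where "\<mu> g = (case qpart g of (x0, x1, _, _) \<Rightarrow> Complex (of_int x0) (of_int x1))" for g
  let ?T = "elts C4 UNIV"
  have T: "subgroup ?T G" "?T \<lhd> G" by (simp_all add: subgroup_elts' normal_elts)
  have "order G div card ?T \<in> char_degrees G"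
  proof (rule induced_irreducible_rep[OF finite_G T subset_refl, where \<mu> = \<mu>])
    fix s t assume "s \<in> ?T" "t \<in> ?T"
    moreover have "(case qm x y of (x0, x1, _, _) \<Rightarrow> Complex (of_int x0) (of_int x1)) =
      (case x of (x0, x1, _, _) \<Rightarrow> Complex (of_int x0) (of_int x1)) * (case y of (x0, x1, _, _) \<Rightarrow> Complex (of_int x0) (of_int x1))"
      if "x \<in> C4" "y \<in> C4" for x y
      using that unfolding C4_def by (auto simp: qm.simps complex_eq_iff)
    ultimately show "\<mu> (s \<otimes>\<^bsub>G\<^esub> t) = \<mu> s * \<mu> t"
      by (elim elts_cases) (simp add: \<mu>_def mult_el)
  next
    show "\<mu> \<one>\<^bsub>G\<^esub> = 1" by (simp add: \<mu>_def one_G complex_eq_iff)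
  next
    fix g assume g: "g \<in> carrier G" and inv: "\<And>y. y \<in> ?T \<Longrightarrow> \<mu> (inv\<^bsub>G\<^esub> g \<otimes>\<^bsub>G\<^esub> y \<otimes>\<^bsub>G\<^esub> g) = \<mu> y"
    let ?i = "el (0,1,0,0) 0 0 0 0 0"
    have i: "?i \<in> ?T" "?i \<in> carrier G" by (simp_all add: C4_def Q8_def)
    have "qpart (inv\<^bsub>G\<^esub> g \<otimes>\<^bsub>G\<^esub> ?i \<otimes>\<^bsub>G\<^esub> g) = qm (qm (qc (qpart g)) (0,1,0,0)) (qpart g)"
      using g i by (simp add: qpart_mult qpart_inv del: carrier_G)
    hence "qpart g \<in> C4" using inv[OF i(1)] qpart_Q8[OF g]
      by (auto simp: \<mu>_def Q8_def C4_def qm.simps qc.simps complex_eq_iff)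
    thus "g \<in> ?T" using g mem_elts_UNIV C4_Q8 by simp
  qed
  thus ?thesis using odd_p by (simp add: order_G card_elts_UNIV card_C)
qed

definition zeta :: "int \<Rightarrow> complex" where "zeta k = cis (2 * pi * real_of_int k / real p)"

lemma zeta_add: "zeta (m + k) = zeta m * zeta k"
  by (simp add: zeta_def cis_mult add_divide_distrib ring_distribs)

lemma zeta_zero [simp]: "zeta 0 = 1" and zeta_p: "zeta (int p) = 1"
  using odd_p by (simp_all add: zeta_def)

lemma zeta_one: "zeta 1 \<noteq> 1"
proof
  assume *: "zeta 1 = 1"
  have "inj_on (\<lambda>k. cis (2 * pi * real k / real p)) {..<p}"
    using bij_betw_roots_unity[of p] odd_p by (simp add: bij_betw_def)
  from inj_onD[OF this, of 0 1] * odd_p show False by (simp add: zeta_def)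
qed

lemma zeta_eq_1_iff: "zeta m = 1 \<longleftrightarrow> int p dvd m"
  by (rule int_character_kernel[OF prime_p zeta_add zeta_zero zeta_p zeta_one])

lemma zeta_cong: "[m = k] (mod int p) \<longleftrightarrow> zeta m = zeta k"
proof -
  have "zeta m = zeta (m - k) * zeta k" by (simp flip: zeta_add)
  moreover have "zeta k \<noteq> 0" by (simp add: zeta_def)
  ultimately show ?thesis using zeta_eq_1_iff by (simp add: cong_iff_dvd_diff)
qed

lemma zeta_mod [simp]: "zeta (m mod int p) = zeta m"
  by (simp flip: zeta_cong)

definition vpart :: "nat \<Rightarrow> int" where
  "vpart g = (case from_nat g :: quat \<times> int \<times> int \<times> int \<times> int \<times> int of (x, u1, u2, v1, v2, z) \<Rightarrow> v1)"

definition zpart :: "nat \<Rightarrow> int" where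
  "zpart g = (case from_nat g :: quat \<times> int \<times> int \<times> int \<times> int \<times> int of (x, u1, u2, v1, v2, z) \<Rightarrow> z)"

lemma parts_el [simp]: "vpart (el x u1 u2 v1 v2 z) = v1 mod int p" "zpart (el x u1 u2 v1 v2 z) = z mod int p"
  by (simp_all add: vpart_def zpart_def el_def)

text \<open>The character of P given by the first coordinate of v. If x is not 1, M(x) - 1 is onto,
  so some vector changes that coordinate by 1 under x, and x does not fix the character.\<close>

lemma eight_in_char_degrees: "8 \<in> char_degrees G"
proof -
  let ?\<mu> = "\<lambda>g. zeta (vpart g)"
  let ?T = "elts {q1} UNIV"
  have T: "subgroup ?T G" "?T \<lhd> G" by (simp_all add: subgroup_elts' normal_elts)
  have "order G div card ?T \<in> char_degrees G"
  proof (rule induced_irreducible_rep[OF finite_G T subset_refl, where \<mu> = ?\<mu>])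
    fix s t assume "s \<in> ?T" "t \<in> ?T"
    thus "?\<mu> (s \<otimes>\<^bsub>G\<^esub> t) = ?\<mu> s * ?\<mu> t"
      by (elim elts_cases) (simp add: mult_el zeta_add)
  next
    show "?\<mu> \<one>\<^bsub>G\<^esub> = 1" by (simp add: one_G)
  next
    fix g assume g: "g \<in> carrier G" and inv: "\<And>y. y \<in> ?T \<Longrightarrow> ?\<mu> (inv\<^bsub>G\<^esub> g \<otimes>\<^bsub>G\<^esub> y \<otimes>\<^bsub>G\<^esub> g) = ?\<mu> y"
    obtain x u1 u2 v1 v2 z where x: "x \<in> Q8" and g': "g = el x u1 u2 v1 v2 z"
      using g unfolding carrier_G by (elim elts_cases)
    have fixed: "zeta (act1 x w1 w2) = zeta w1" for w1 w2
      using conj_invariant[where \<mu> = ?\<mu>, OF T(2) g _ inv, of "el q1 0 0 w1 w2 0"] x by (simp add: g' conj_el)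
    have "x = q1"
    proof (rule ccontr)
      assume "x \<noteq> q1"
      then obtain w1 w2 where "[act1 x w1 w2 - w1 = 1] (mod int p)" using act_minus_one_surj[OF x] by blast
      moreover have "zeta (act1 x w1 w2) = zeta (act1 x w1 w2 - w1) * zeta w1" by (simp flip: zeta_add)
      ultimately have "zeta 1 * zeta w1 = zeta w1" using fixed by (simp add: zeta_cong)
      thus False using zeta_one by (simp add: zeta_def)
    qed
    thus "g \<in> ?T" by (simp add: g')
  qed
  thus ?thesis using odd_p by (simp add: order_G card_elts_UNIV card_C)
qed

text \<open>Conjugation turns \<open>l t\<close> into \<open>l (chi x * t + u . w)\<close>. Taking t
  = 0 and basis vectors w forces u = 0; taking w = 0 and t = 1 forces \<open>chi x = 1\<close>. It
  serves both the existence of degree 2 p^2 and the exclusion of others.\<close>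

lemma central_character_stabilizer:
  fixes l :: "int \<Rightarrow> complex"
  assumes add: "\<And>m k. l (m + k) = l m * l k" and zero: "l 0 = 1" and per: "l (int p) = 1" and nontrivial: "l c \<noteq> 1"
    and \<mu>: "\<And>v1 v2 z. \<mu> (el q1 0 0 v1 v2 z) = l z"
    and g: "g \<in> carrier G" and inv: "\<And>y. y \<in> elts {q1} {0} \<Longrightarrow> \<mu> (inv\<^bsub>G\<^esub> g \<otimes>\<^bsub>G\<^esub> y \<otimes>\<^bsub>G\<^esub> g) = \<mu> y"
  shows "g \<in> elts C4 {0}"
proof -
  note ker = int_character_kernel[OF prime_p add zero per nontrivial]
  obtain x u1 u2 v1 v2 z where x: "x \<in> Q8" and g': "g = el x u1 u2 v1 v2 z"
    using g unfolding carrier_G by (elim elts_cases)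
  have fixed: "l (chi x * t + (u1 * w1 + u2 * w2)) = l t" for w1 w2 t
    using conj_invariant[where \<mu> = \<mu>, OF normal_N g _ inv, of "el q1 0 0 w1 w2 t"] x by (simp add: g' conj_el \<mu>)
  have "int p dvd u1" "int p dvd u2"
    using fixed[of 0 1 0] fixed[of 0 0 1] by (simp_all add: zero ker)
  moreover have "x \<in> C4"
  proof (rule ccontr)
    assume "x \<notin> C4"
    \<comment> \<open>A central character fixed by inversion would satisfy l 2 = 1, impossible for
      odd p.\<close>
    hence "l (- 1) = l 1" using fixed[of 1 0 0] x by (simp add: chi_Q8)
    moreover have "l 2 = l 1 * l 1" using add[of 1 1] by simp
    moreover have "l 1 * l (- 1) = 1" using add[of 1 "- 1"] zero by simp
    ultimately have "l 2 = 1" by simp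
    hence "int p dvd 2" by (simp add: ker)
    thus False using odd_p zdvd_imp_le by force
  qed
  ultimately have "g = el x 0 0 v1 v2 z" "x \<in> C4" by (simp_all add: g' el_eq_iff cong_0_iff)
  thus ?thesis by simp
qed

lemma order_eq: "order G = 2 * p ^ 2 * card (elts C4 {0})"
  using card_elts[of "{0}" 1 C4] by (simp add: card_C order_G flip: power_add)

text \<open>On \<open>elts C4 {0}\<close> the corner entry is additive, since \<open>chi\<close> is
  1 there and u vanishes; hence the central character extends to a linear character, although C4
  acts nontrivially on v.\<close>

lemma two_p2_in_char_degrees: "2 * p ^ 2 \<in> char_degrees G"
proof -
  let ?\<mu> = "\<lambda>g. zeta (zpart g)"
  let ?T = "elts C4 {0}"
  have T: "subgroup ?T G" by (simp add: subgroup_elts')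
  have "order G div card ?T \<in> char_degrees G"
  proof (rule induced_irreducible_rep[OF finite_G T normal_N, where \<mu> = ?\<mu>])
    show "elts {q1} {0} \<subseteq> ?T" by (auto elim!: elts_cases)
    show "?\<mu> (s \<otimes>\<^bsub>G\<^esub> t) = ?\<mu> s * ?\<mu> t" if "s \<in> ?T" "t \<in> ?T" for s t
      using that subsetD[OF C4_Q8] by (elim elts_cases) (simp add: mult_el zeta_add chi_Q8)
    show "?\<mu> \<one>\<^bsub>G\<^esub> = 1" by (simp add: one_G)
    show "g \<in> ?T" if "g \<in> carrier G" "\<And>y. y \<in> elts {q1} {0} \<Longrightarrow> ?\<mu> (inv\<^bsub>G\<^esub> g \<otimes>\<^bsub>G\<^esub> y \<otimes>\<^bsub>G\<^esub> g) = ?\<mu> y" for g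
      by (rule central_character_stabilizer[OF zeta_add zeta_zero zeta_p zeta_one, where \<mu> = ?\<mu>]) (use that in simp_all)
  qed
  moreover have "card ?T > 0" using order_eq order_G odd_p by (cases "card ?T") auto
  ultimately show ?thesis by (simp add: order_eq)
qed

end

section \<open>Exclusion of all other degrees\<close>

lemma (in finite_group_rep) common_eigenvector_fixed:
  assumes T: "T \<subseteq> carrier G" and K: "K \<lhd> G"
    and w: "w \<in> carrier_vec n" "w \<noteq> 0\<^sub>v n" "\<And>k. k \<in> K \<Longrightarrow> \<rho> k *\<^sub>v w = w"
    and comm: "\<And>s t. s \<in> T \<Longrightarrow> t \<in> T \<Longrightarrow> \<exists>k\<in>K. s \<otimes> t = t \<otimes> s \<otimes> k"
  shows "\<exists>v \<mu>. v \<in> carrier_vec n \<and> v \<noteq> 0\<^sub>v n \<and> (\<forall>k\<in>K. \<rho> k *\<^sub>v v = v) \<and> (\<forall>t\<in>T. \<rho> t *\<^sub>v v = \<mu> t \<cdot>\<^sub>v v)"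
proof -
  have "\<exists>v \<mu>. v \<in> carrier_vec n \<and> v \<noteq> 0\<^sub>v n \<and> (\<forall>k\<in>K. \<rho> k *\<^sub>v v = 1 \<cdot>\<^sub>v v) \<and> (\<forall>t\<in>T. \<rho> t *\<^sub>v v = \<mu> t \<cdot>\<^sub>v v)"
  proof (rule common_eigenvector[OF T subgroup.subset[OF normal_imp_subgroup[OF K]] w(1,2), where \<kappa> = "\<lambda>_. 1"])
  show "inv t \<otimes> k \<otimes> t \<in> K \<and> (1::complex) = 1" if "t \<in> T" "k \<in> K" for t k
    using normal.inv_op_closed1[OF K _ that(2), of t] that(1) T by blast
  qed (use w comm in auto)
  thus ?thesis by simp
qed

context q8_heisenberg
begin

lemma commute_modulo_elts:
  assumes "s \<in> carrier G" "t \<in> carrier G" "A \<subseteq> Q8"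
    "qm (qc (qm (qpart t) (qpart s))) (qm (qpart s) (qpart t)) \<in> A"
  shows "\<exists>k\<in>elts A UNIV. s \<otimes>\<^bsub>G\<^esub> t = t \<otimes>\<^bsub>G\<^esub> s \<otimes>\<^bsub>G\<^esub> k"
proof (rule bexI)
  let ?k = "inv\<^bsub>G\<^esub> (t \<otimes>\<^bsub>G\<^esub> s) \<otimes>\<^bsub>G\<^esub> (s \<otimes>\<^bsub>G\<^esub> t)"
  have G: "t \<otimes>\<^bsub>G\<^esub> s \<in> carrier G" "s \<otimes>\<^bsub>G\<^esub> t \<in> carrier G" "?k \<in> carrier G" using assms(1,2) by blast+
  show "s \<otimes>\<^bsub>G\<^esub> t = t \<otimes>\<^bsub>G\<^esub> s \<otimes>\<^bsub>G\<^esub> ?k" using inv_cancel_left(1)[OF G(1,2)] by simp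
  have "qpart ?k = qm (qc (qm (qpart t) (qpart s))) (qm (qpart s) (qpart t))"
    using assms(1,2) G by (simp only: qpart_mult qpart_inv inv_closed)
  thus "?k \<in> elts A UNIV" using assms(3,4) G(3) mem_elts_UNIV by simp
qed

lemma elts_sub_G: "A \<in> {{q1}, C2, C4, Q8} \<Longrightarrow> J \<in> {UNIV, {0}} \<Longrightarrow> elts A J \<subseteq> carrier G"
  by (rule subgroup.subset[OF subgroup_elts'])

text \<open>The factorisation of G as Q8 times P. It shows that a weight trivial on P depends on the
  quaternion part only.\<close>

lemma el_factor: "x \<in> Q8 \<Longrightarrow> el x u1 u2 v1 v2 z = el x 0 0 0 0 0 \<otimes>\<^bsub>G\<^esub>
    el q1 (chi x * u1) (chi x * u2) (act1 (qc x) v1 v2) (act2 (qc x) v1 v2) (chi x * z)"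
proof -
  assume x: "x \<in> Q8"
  have "chi x * chi x = 1" using x by (simp add: chi_Q8)
  hence sq: "chi x * (chi x * t) = t" for t by (simp flip: mult.assoc)
  show ?thesis using act_inverse[OF x, of v1 v2] by (simp add: mult_el el_eq_iff cong_sym sq)
qed

end

locale q8_irrep = q8_heisenberg +
  fixes n :: nat and \<rho> :: "nat \<Rightarrow> complex mat"
  assumes irr: "irreducible_rep G n \<rho>"
begin

sublocale finite_group_rep G n \<rho>
  by unfold_locales (use finite_G irr in \<open>simp_all add: irreducible_rep_def\<close>)

text \<open>A weight of N has the form l(r.v + z), where l is its nontrivial restriction to the
  centre. Translating by the group element with u = r removes r; what remains depends on z alone and
  is fixed by T = \<open>elts C4 {0}\<close>, so T has an eigenvector extending it and the degree is
  the index of T.\<close>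

lemma degree_central_nontrivial:
  assumes w: "w \<in> carrier_vec n" "w \<noteq> 0\<^sub>v n" "\<And>t. t \<in> elts {q1} {0} \<Longrightarrow> \<rho> t *\<^sub>v w = \<mu> t \<cdot>\<^sub>v w"
    and c: "\<mu> (el q1 0 0 0 0 c) \<noteq> 1"
  shows "n = 2 * p ^ 2"
proof -
  let ?N = "elts {q1} {0}"
  have N: "subgroup ?N G" by (simp add: subgroup_elts')
  note hom = eigenvalue_hom[OF N w]
  define l where "l k = \<mu> (el q1 0 0 0 0 k)" for k
  have l_add: "l (m + k) = l m * l k" for m k
    using hom(1)[of "el q1 0 0 0 0 m" "el q1 0 0 0 0 k"] by (simp add: l_def mult_el add.commute)
  have l_zero: "l 0 = 1" using hom(2) by (simp add: l_def one_G)
  have l_cong: "l m = l k" if "[m = k] (mod int p)" for m k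
  proof -
    have "el q1 0 0 0 0 m = el q1 0 0 0 0 k" using that by (simp add: el_eq_iff)
    thus ?thesis by (simp only: l_def)
  qed
  have l_p: "l (int p) = 1" using l_cong[of "int p" 0] l_zero by (simp add: cong_0_iff)
  have l_c: "l c \<noteq> 1" using c by (simp add: l_def)
  \<comment> \<open>Self-duality of the integers modulo p: every character is \<open>l\<close>
    composed with a multiplication, since its value at 1 is a p-th root of unity and hence a value
    of \<open>l\<close>.\<close>
  have linear: "\<exists>u. \<forall>v. f v = l (u * v)"
    if f: "\<And>m k. f (m + k) = f m * f k" "f 0 = 1" "\<And>m k. [m = k] (mod int p) \<Longrightarrow> f m = f k" for f :: "int \<Rightarrow> complex"
  proof -
    have "f 1 ^ p = f (int p * 1)" using int_character_mult[OF f(1,2), of p 1] by simp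
    also have "\<dots> = 1" using f(3)[of "int p" 0] f(2) by (simp add: cong_0_iff)
    finally obtain u where u: "f 1 = l u"
      using int_character_roots[OF prime_p l_add l_zero l_p l_c] by blast
    have "f v = l (u * v)" for v
    proof -
      define k where "k = nat (v mod int p)"
      have k: "[v = int k] (mod int p)" using p_pos by (simp add: k_def cong_sym)
      have "f v = f (int k * 1)" using f(3)[OF k] by simp
      also have "\<dots> = l u ^ k" using int_character_mult[OF f(1,2), of k 1] u by simp
      also have "\<dots> = l (int k * u)" by (rule int_character_mult[OF l_add l_zero, symmetric])
      also have "\<dots> = l (u * v)" by (rule l_cong) (use cong_mult[OF cong_sym[OF k] cong_refl[of u]] in \<open>simp add: mult.commute\<close>)
      finally show ?thesis .
    qed
    thus ?thesis by blast
  qed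
  have cong_\<mu>: "\<mu> (el q1 0 0 m 0 0) = \<mu> (el q1 0 0 k 0 0)" "\<mu> (el q1 0 0 0 m 0) = \<mu> (el q1 0 0 0 k 0)"
    if "[m = k] (mod int p)" for m k
  proof -
    have "el q1 0 0 m 0 0 = el q1 0 0 k 0 0" "el q1 0 0 0 m 0 = el q1 0 0 0 k 0"
      using that by (simp_all add: el_eq_iff)
    thus "\<mu> (el q1 0 0 m 0 0) = \<mu> (el q1 0 0 k 0 0)" "\<mu> (el q1 0 0 0 m 0) = \<mu> (el q1 0 0 0 k 0)"
      by simp_all
  qed
  obtain r1 where r1: "\<And>v. \<mu> (el q1 0 0 v 0 0) = l (r1 * v)"
  proof -
    have "\<mu> (el q1 0 0 (m + k) 0 0) = \<mu> (el q1 0 0 m 0 0) * \<mu> (el q1 0 0 k 0 0)" for m k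
      using hom(1)[of "el q1 0 0 m 0 0" "el q1 0 0 k 0 0"] by (simp add: mult_el add.commute)
    from linear[OF this _ cong_\<mu>(1)] hom(2) that show thesis by (auto simp: one_G)
  qed
  obtain r2 where r2: "\<And>v. \<mu> (el q1 0 0 0 v 0) = l (r2 * v)"
  proof -
    have "\<mu> (el q1 0 0 0 (m + k) 0) = \<mu> (el q1 0 0 0 m 0) * \<mu> (el q1 0 0 0 k 0)" for m k
      using hom(1)[of "el q1 0 0 0 m 0" "el q1 0 0 0 k 0"] by (simp add: mult_el add.commute)
    from linear[OF this _ cong_\<mu>(2)] hom(2) that show thesis by (auto simp: one_G)
  qed
  have \<mu>: "\<mu> (el q1 0 0 v1 v2 z) = l (r1 * v1 + r2 * v2 + z)" for v1 v2 z
  proof -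
    have "el q1 0 0 v1 v2 z = el q1 0 0 v1 0 0 \<otimes>\<^bsub>G\<^esub> el q1 0 0 0 v2 0 \<otimes>\<^bsub>G\<^esub> el q1 0 0 0 0 z"
      by (simp add: mult_el)
    moreover have "el q1 0 0 v1 0 0 \<otimes>\<^bsub>G\<^esub> el q1 0 0 0 v2 0 \<in> ?N" by (simp add: mult_el)
    ultimately show ?thesis by (simp add: hom r1 r2 l_add) (simp add: l_def)
  qed
  \<comment> \<open>Moving (v, z) past the element with u = r subtracts r.v from z, which cancels
    the r.v term of the weight.\<close>
  define w1 where "w1 = \<rho> (el q1 r1 r2 0 0 0) *\<^sub>v w"
  have w1: "w1 \<in> carrier_vec n" using w(1) by (simp add: w1_def)
  have "w1 \<noteq> 0\<^sub>v n"
  proof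
    assume "w1 = 0\<^sub>v n"
    hence "\<rho> (inv\<^bsub>G\<^esub> el q1 r1 r2 0 0 0) *\<^sub>v (\<rho> (el q1 r1 r2 0 0 0) *\<^sub>v w) = 0\<^sub>v n"
      by (metis w1_def rho_zero inv_closed el_q1_in_G)
    hence "\<rho> (inv\<^bsub>G\<^esub> el q1 r1 r2 0 0 0 \<otimes>\<^bsub>G\<^esub> el q1 r1 r2 0 0 0) *\<^sub>v w = 0\<^sub>v n"
      using w(1) el_q1_in_G by (metis rho_mult inv_closed)
    thus False using w el_q1_in_G by (metis l_inv rho_one)
  qed
  have w1_N: "\<rho> (el q1 0 0 v1 v2 z) *\<^sub>v w1 = l z \<cdot>\<^sub>v w1" for v1 v2 z
  proof -
    have "\<rho> (el q1 0 0 v1 v2 z) *\<^sub>v w1 = \<rho> (el q1 0 0 v1 v2 z \<otimes>\<^bsub>G\<^esub> el q1 r1 r2 0 0 0) *\<^sub>v w"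
      using w(1) by (simp add: w1_def rho_mult)
    also have "el q1 0 0 v1 v2 z \<otimes>\<^bsub>G\<^esub> el q1 r1 r2 0 0 0 =
        el q1 r1 r2 0 0 0 \<otimes>\<^bsub>G\<^esub> el q1 0 0 v1 v2 (z - (r1 * v1 + r2 * v2))"
      by (simp add: mult_el)
    also have "\<rho> \<dots> *\<^sub>v w = \<rho> (el q1 r1 r2 0 0 0) *\<^sub>v (\<rho> (el q1 0 0 v1 v2 (z - (r1 * v1 + r2 * v2))) *\<^sub>v w)"
      using w(1) by (simp add: rho_mult)
    also have "\<dots> = l z \<cdot>\<^sub>v w1" using w by (simp add: w1_def rho_smult \<mu>)
    finally show ?thesis .
  qed
  have l_mod: "l (z mod int p) = l z" for z by (rule l_cong) simp
  let ?T = "elts C4 {0}"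
  have T: "subgroup ?T G" by (simp add: subgroup_elts')
  \<comment> \<open>Elements of \<open>?T\<close> have u = 0 and \<open>chi\<close> equal to 1, so
    conjugation by them preserves z and hence the weight; their commutators lie in the part of N
    with z = 0, where the weight is 1.\<close>
  have "\<exists>v \<nu>. v \<in> carrier_vec n \<and> v \<noteq> 0\<^sub>v n \<and> (\<forall>k\<in>?N. \<rho> k *\<^sub>v v = l (zpart k) \<cdot>\<^sub>v v) \<and>
      (\<forall>t\<in>?T. \<rho> t *\<^sub>v v = \<nu> t \<cdot>\<^sub>v v)"
  proof (rule common_eigenvector[OF subgroup.subset[OF T] subgroup.subset[OF N] w1 \<open>w1 \<noteq> 0\<^sub>v n\<close>, where \<kappa> = "\<lambda>k. l (zpart k)"])
    show "\<rho> k *\<^sub>v w1 = l (zpart k) \<cdot>\<^sub>v w1" if "k \<in> ?N" for k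
      using that by (elim elts_cases) (simp add: w1_N l_mod)
  next
    fix t k assume t: "t \<in> ?T" and k: "k \<in> ?N"
    have "inv\<^bsub>G\<^esub> t \<in> ?T" using T t by (rule subgroup.m_inv_closed)
    then obtain x v1 v2 z where x: "x \<in> C4" and s: "inv\<^bsub>G\<^esub> t = el x 0 0 v1 v2 z" by (elim elts_cases) auto
    have xQ: "x \<in> Q8" using x C4_Q8 by blast
    obtain w1 w2 z' where k': "k = el q1 0 0 w1 w2 z'" using k by (elim elts_cases) auto
    have "t \<in> carrier G" using T t by (rule subgroup.mem_carrier)
    hence "inv\<^bsub>G\<^esub> t \<otimes>\<^bsub>G\<^esub> k \<otimes>\<^bsub>G\<^esub> t = el x 0 0 v1 v2 z \<otimes>\<^bsub>G\<^esub> k \<otimes>\<^bsub>G\<^esub> inv\<^bsub>G\<^esub> (el x 0 0 v1 v2 z)"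
      by (metis s inv_inv)
    also have "\<dots> = el q1 0 0 (act1 x w1 w2) (act2 x w1 w2) z'"
      unfolding k' conj_el[OF xQ] using x xQ by (simp add: chi_Q8)
    finally show "inv\<^bsub>G\<^esub> t \<otimes>\<^bsub>G\<^esub> k \<otimes>\<^bsub>G\<^esub> t \<in> ?N \<and> l (zpart (inv\<^bsub>G\<^esub> t \<otimes>\<^bsub>G\<^esub> k \<otimes>\<^bsub>G\<^esub> t)) = l (zpart k)"
      by (simp add: k')
  next
    fix s t assume s: "s \<in> ?T" and t: "t \<in> ?T"
    obtain x v1 v2 z where x: "x \<in> C4" and s': "s = el x 0 0 v1 v2 z" using s by (elim elts_cases) auto
    obtain y w1 w2 z' where y: "y \<in> C4" and t': "t = el y 0 0 w1 w2 z'" using t by (elim elts_cases) auto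
    have Q: "x \<in> Q8" "y \<in> Q8" using x y C4_Q8 by auto
    define d1 where "d1 = act1 x w1 w2 + v1 - (act1 y v1 v2 + w1)"
    define d2 where "d2 = act2 x w1 w2 + v2 - (act2 y v1 v2 + w2)"
    let ?q = "qm y x"
    \<comment> \<open>The vector parts of st and ts differ by d. A right factor k contributes M(yx)
      k, so k is M(yx)^{-1} d; the corner entries of st and ts already agree.\<close>
    let ?k = "el q1 0 0 (act1 (qc ?q) d1 d2) (act2 (qc ?q) d1 d2) 0"
    have q: "?q \<in> Q8" using Q by (simp add: qm_Q8)
    have "[act1 x w1 w2 + v1 = act1 ?q (act1 (qc ?q) d1 d2) (act2 (qc ?q) d1 d2) + (act1 y v1 v2 + w1)] (mod int p)"
      using cong_add[OF cong_sym[OF act_inverse(1)[OF q, of d1 d2]] cong_refl[of "act1 y v1 v2 + w1"]] by (simp add: d1_def)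
    moreover have "[act2 x w1 w2 + v2 = act2 ?q (act1 (qc ?q) d1 d2) (act2 (qc ?q) d1 d2) + (act2 y v1 v2 + w2)] (mod int p)"
      using cong_add[OF cong_sym[OF act_inverse(2)[OF q, of d1 d2]] cong_refl[of "act2 y v1 v2 + w2"]] by (simp add: d2_def)
    ultimately have "s \<otimes>\<^bsub>G\<^esub> t = t \<otimes>\<^bsub>G\<^esub> s \<otimes>\<^bsub>G\<^esub> ?k"
      using x y Q by (simp add: s' t' mult_el el_eq_iff chi_Q8 qm_C4_commute add.commute[of z z'])
    moreover have "?k \<in> ?N \<and> l (zpart ?k) = 1" by (simp add: l_zero)
    ultimately show "\<exists>k\<in>?N. s \<otimes>\<^bsub>G\<^esub> t = t \<otimes>\<^bsub>G\<^esub> s \<otimes>\<^bsub>G\<^esub> k \<and> l (zpart k) = 1" by blast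
  qed
  then obtain v \<nu> where v: "v \<in> carrier_vec n" "v \<noteq> 0\<^sub>v n" "\<And>k. k \<in> ?N \<Longrightarrow> \<rho> k *\<^sub>v v = l (zpart k) \<cdot>\<^sub>v v"
    and \<nu>: "\<And>t. t \<in> ?T \<Longrightarrow> \<rho> t *\<^sub>v v = \<nu> t \<cdot>\<^sub>v v" by blast
  have NT: "?N \<subseteq> ?T" by (auto elim!: elts_cases)
  have \<nu>_N: "\<nu> (el q1 0 0 v1 v2 z) = l z" for v1 v2 z
  proof (rule eigenvalue_unique[OF v(1,2)])
    have "el q1 0 0 v1 v2 z \<in> ?N" by simp
    thus "\<nu> (el q1 0 0 v1 v2 z) \<cdot>\<^sub>v v = l z \<cdot>\<^sub>v v"
      using v(3)[of "el q1 0 0 v1 v2 z"] \<nu>[of "el q1 0 0 v1 v2 z"] NT l_mod by auto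
  qed
  have "n * card ?T = order G"
  proof (rule degree_eq_index[OF irr T normal_N NT v(1,2) \<nu>])
    fix g assume "g \<in> carrier G" "\<And>y. y \<in> ?N \<Longrightarrow> \<nu> (inv\<^bsub>G\<^esub> g \<otimes>\<^bsub>G\<^esub> y \<otimes>\<^bsub>G\<^esub> g) = \<nu> y"
    thus "g \<in> ?T"
      by (rule central_character_stabilizer[where \<mu> = \<nu>, OF l_add l_zero l_p l_c \<nu>_N])
  qed
  moreover have "card ?T > 0" using order_eq order_G odd_p by (cases "card ?T") auto
  ultimately show ?thesis using order_eq by simp
qed

text \<open>Suppose some x other than 1 stabilises \<mu>. Every vector of either copy of W is then a
  difference of a vector and its image under a nontrivial element of Q8, which forces \<mu> to be 1
  on both copies. With triviality on the centre this makes \<mu> trivial on P.\<close>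

lemma degree_linear_nontrivial:
  assumes w: "w \<in> carrier_vec n" "w \<noteq> 0\<^sub>v n" "\<And>t. t \<in> elts {q1} UNIV \<Longrightarrow> \<rho> t *\<^sub>v w = \<mu> t \<cdot>\<^sub>v w"
    and Z: "\<And>z. \<mu> (el q1 0 0 0 0 z) = 1"
    and c: "y0 \<in> elts {q1} UNIV" "\<mu> y0 \<noteq> 1"
  shows "n = 8"
proof -
  let ?T = "elts {q1} UNIV"
  have T: "subgroup ?T G" "?T \<lhd> G" by (simp_all add: subgroup_elts' normal_elts)
  note hom = eigenvalue_hom[OF T(1) w]
  have "n * card ?T = order G"
  proof (rule degree_eq_index[OF irr T subset_refl w])
    fix g assume g: "g \<in> carrier G" and inv: "\<And>y. y \<in> ?T \<Longrightarrow> \<mu> (inv\<^bsub>G\<^esub> g \<otimes>\<^bsub>G\<^esub> y \<otimes>\<^bsub>G\<^esub> g) = \<mu> y"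
    obtain x u1 u2 v1 v2 z where x: "x \<in> Q8" and g': "g = el x u1 u2 v1 v2 z"
      using g unfolding carrier_G by (elim elts_cases)
    have "x = q1"
    proof (rule ccontr)
      assume ne: "x \<noteq> q1"
      have V: "\<mu> (el q1 0 0 w1 w2 t) = 1" for w1 w2 t
      proof -
        obtain s1 s2 where s: "[act1 x s1 s2 - s1 = w1] (mod int p)" "[act2 x s1 s2 - s2 = w2] (mod int p)"
          using act_minus_one_surj[OF x ne] by blast
        have "\<mu> (el q1 0 0 (act1 x s1 s2) (act2 x s1 s2) (u1 * s1 + u2 * s2)) = \<mu> (el q1 0 0 s1 s2 0)"
          using conj_invariant[where \<mu> = \<mu>, OF T(2) g _ inv, of "el q1 0 0 s1 s2 0"] x by (simp add: g' conj_el)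
        moreover have "el q1 0 0 (act1 x s1 s2) (act2 x s1 s2) (u1 * s1 + u2 * s2) =
            el q1 0 0 w1 w2 t \<otimes>\<^bsub>G\<^esub> (el q1 0 0 s1 s2 0 \<otimes>\<^bsub>G\<^esub> el q1 0 0 0 0 (u1 * s1 + u2 * s2 - t))"
          using cong_add[OF s(1) cong_refl[of s1]] cong_add[OF s(2) cong_refl[of s2]]
          by (simp add: mult_el el_eq_iff add.commute)
        ultimately have "\<mu> (el q1 0 0 w1 w2 t) * \<mu> (el q1 0 0 s1 s2 0) = \<mu> (el q1 0 0 s1 s2 0)"
          by (simp add: hom Z subgroup.m_closed[OF T(1)])
        moreover have "\<mu> (el q1 0 0 s1 s2 0) * \<mu> (el q1 0 0 (- s1) (- s2) 0) = 1"
          using hom(1)[of "el q1 0 0 s1 s2 0" "el q1 0 0 (- s1) (- s2) 0"] hom(2) by (simp add: mult_el one_G)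
        ultimately show ?thesis by auto
      qed
      have U: "\<mu> (el q1 w1 w2 0 0 0) = 1" for w1 w2
      proof -
        \<comment> \<open>Conjugation by the inverse of g acts on u by chi(x) M(x)^T. This is M(y)
          for an element y of Q8, as -1 acts by negation, so surjectivity of M(y) - 1 applies here
          too.\<close>
        define y where "y = (if chi x = 1 then qt x else qm mq (qt x))"
        have chi: "chi x = 1 \<or> chi x = -1" using x by (simp add: chi_Q8)
        have y: "y \<in> Q8" using x by (simp add: y_def qt_Q8 qm_Q8 del: mq_simps(4))
        have act_y: "act1 y s1 s2 = chi x * act1 (qt x) s1 s2" "act2 y s1 s2 = chi x * act2 (qt x) s1 s2" for s1 s2
          using chi by (cases x; auto simp: y_def qt.simps qm.simps act1.simps act2.simps algebra_simps)+
        have "y \<noteq> q1" using ne x by (auto simp: y_def Q8_def qt.simps qm.simps chi.simps)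
        then obtain s1 s2 where s: "[act1 y s1 s2 - s1 = w1] (mod int p)" "[act2 y s1 s2 - s2 = w2] (mod int p)"
          using act_minus_one_surj[OF y] by blast
        have chi2: "chi x * (chi x * t) = t" for t using chi by auto
        let ?h = "el q1 (act1 y s1 s2) (act2 y s1 s2) 0 0 0"
        have "g \<otimes>\<^bsub>G\<^esub> ?h = el q1 s1 s2 0 0 (- (s1 * v1 + s2 * v2)) \<otimes>\<^bsub>G\<^esub> g"
          by (simp add: g' mult_el act_y chi2 add.commute)
        hence "g \<otimes>\<^bsub>G\<^esub> ?h \<otimes>\<^bsub>G\<^esub> inv\<^bsub>G\<^esub> g = el q1 s1 s2 0 0 (- (s1 * v1 + s2 * v2))"
          by (rule conj_eqI) (use g in simp_all)
        hence "\<mu> ?h = \<mu> (el q1 s1 s2 0 0 (- (s1 * v1 + s2 * v2)))"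
          using conj_invariant[where \<mu> = \<mu>, OF T(2) g _ inv, of ?h] by simp
        also have "el q1 s1 s2 0 0 (- (s1 * v1 + s2 * v2)) = el q1 s1 s2 0 0 0 \<otimes>\<^bsub>G\<^esub> el q1 0 0 0 0 (- (s1 * v1 + s2 * v2))"
          by (simp add: mult_el)
        also have "\<mu> \<dots> = \<mu> (el q1 s1 s2 0 0 0)" by (simp add: hom Z)
        finally have "\<mu> ?h = \<mu> (el q1 s1 s2 0 0 0)" .
        moreover have "?h = el q1 w1 w2 0 0 0 \<otimes>\<^bsub>G\<^esub> el q1 s1 s2 0 0 0"
          using cong_add[OF s(1) cong_refl[of s1]] cong_add[OF s(2) cong_refl[of s2]]
          by (simp add: mult_el el_eq_iff add.commute)
        ultimately have "\<mu> (el q1 w1 w2 0 0 0) * \<mu> (el q1 s1 s2 0 0 0) = \<mu> (el q1 s1 s2 0 0 0)"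
          by (simp add: hom)
        moreover have "\<mu> (el q1 s1 s2 0 0 0) * \<mu> (el q1 (- s1) (- s2) 0 0 0) = 1"
          using hom(1)[of "el q1 s1 s2 0 0 0" "el q1 (- s1) (- s2) 0 0 0"] hom(2) by (simp add: mult_el one_G)
        ultimately show ?thesis by auto
      qed
      obtain a1 a2 b1 b2 t where y0: "y0 = el q1 a1 a2 b1 b2 t" using c(1) by (elim elts_cases) auto
      have "y0 = el q1 0 0 b1 b2 t \<otimes>\<^bsub>G\<^esub> el q1 a1 a2 0 0 0" by (simp add: y0 mult_el)
      hence "\<mu> y0 = 1" by (simp add: hom U V)
      with c(2) show False ..
    qed
    thus "g \<in> ?T" by (simp add: g')
  qed
  thus ?thesis using odd_p by (simp add: order_G card_elts_UNIV card_C)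
qed

text \<open>The weight is a character m of C4 with m(-1) not 1, hence m(i) and m(-i) differ. An
  element outside C4 interchanges i and -i, so the stabiliser is P C4.\<close>

lemma degree_C4_nontrivial:
  assumes w: "w \<in> carrier_vec n" "w \<noteq> 0\<^sub>v n" "\<And>t. t \<in> elts C4 UNIV \<Longrightarrow> \<rho> t *\<^sub>v w = \<mu> t \<cdot>\<^sub>v w"
    and P: "\<And>t. t \<in> elts {q1} UNIV \<Longrightarrow> \<mu> t = 1"
    and c: "\<mu> (el mq 0 0 0 0 0) \<noteq> 1"
  shows "n = 2"
proof -
  let ?T = "elts C4 UNIV"
  have T: "subgroup ?T G" "?T \<lhd> G" by (simp_all add: subgroup_elts' normal_elts)
  note hom = eigenvalue_hom[OF T(1) w]
  define m where "m x = \<mu> (el x 0 0 0 0 0)" for x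
  have \<mu>: "\<mu> t = m (qpart t)" if "t \<in> ?T" for t
  proof -
    obtain x u1 u2 v1 v2 z where x: "x \<in> C4" and t: "t = el x u1 u2 v1 v2 z"
      using \<open>t \<in> ?T\<close> by (elim elts_cases)
    have "x \<in> Q8" using x C4_Q8 by blast
    hence "t = el x 0 0 0 0 0 \<otimes>\<^bsub>G\<^esub> el q1 (chi x * u1) (chi x * u2) (act1 (qc x) v1 v2) (act2 (qc x) v1 v2) (chi x * z)"
      unfolding t by (rule el_factor)
    hence "\<mu> t = \<mu> (el x 0 0 0 0 0)" using x by (simp add: hom P)
    thus ?thesis by (simp add: m_def t)
  qed
  have m_hom: "m (qm x y) = m x * m y" if "x \<in> C4" "y \<in> C4" for x y
    using hom(1)[of "el x 0 0 0 0 0" "el y 0 0 0 0 0"] that by (simp add: m_def mult_el)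
  have "n * card ?T = order G"
  proof (rule degree_eq_index[OF irr T subset_refl w])
    fix g assume g: "g \<in> carrier G" and inv: "\<And>y. y \<in> ?T \<Longrightarrow> \<mu> (inv\<^bsub>G\<^esub> g \<otimes>\<^bsub>G\<^esub> y \<otimes>\<^bsub>G\<^esub> g) = \<mu> y"
    let ?i = "el (0,1,0,0) 0 0 0 0 0"
    have i: "?i \<in> ?T" "?i \<in> carrier G" "(0,1,0,0) \<in> C4" "(0,-1,0,0) \<in> C4" by (simp_all add: C4_def Q8_def)
    have conj: "inv\<^bsub>G\<^esub> g \<otimes>\<^bsub>G\<^esub> ?i \<otimes>\<^bsub>G\<^esub> g \<in> ?T" by (rule normal.inv_op_closed1[OF T(2) g i(1)])
    have q: "qpart (inv\<^bsub>G\<^esub> g \<otimes>\<^bsub>G\<^esub> ?i \<otimes>\<^bsub>G\<^esub> g) = qm (qm (qc (qpart g)) (0,1,0,0)) (qpart g)"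
      using g i by (simp add: qpart_mult qpart_inv del: carrier_G)
    have "qpart g \<in> C4"
    proof (rule ccontr)
      assume "qpart g \<notin> C4"
      hence "qm (qm (qc (qpart g)) (0,1,0,0)) (qpart g) = (0,-1,0,0)"
        using qpart_Q8[OF g] by (auto simp: Q8_def C4_def qm.simps qc.simps)
      hence "m (0,-1,0,0) = m (0,1,0,0)" using inv[OF i(1)] \<mu>[OF conj] \<mu>[OF i(1)] q by simp
      moreover have "m (0,1,0,0) * m (0,-1,0,0) = m q1" "m (0,1,0,0) * m (0,1,0,0) = m mq"
        using m_hom[OF i(3,4)] m_hom[OF i(3,3)] by (simp_all add: qm.simps)
      moreover have "m q1 = 1" using hom(2) by (simp add: m_def one_G)
      ultimately show False using c by (simp add: m_def)
    qed
    thus "g \<in> ?T" using g mem_elts_UNIV C4_Q8 by simp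
  qed
  thus ?thesis using odd_p by (simp add: order_G card_elts_UNIV card_C)
qed

lemma degree_linear:
  assumes w: "w \<in> carrier_vec n" "w \<noteq> 0\<^sub>v n" "\<And>t. t \<in> carrier G \<Longrightarrow> \<rho> t *\<^sub>v w = \<mu> t \<cdot>\<^sub>v w"
  shows "n = 1"
proof -
  have "n * card (carrier G) = order G"
    by (rule degree_eq_index[OF irr subgroup_self _ subset_refl w]) (use normal_elts[of Q8] in simp_all)
  moreover have "order G > 0" using order_G odd_p by simp
  ultimately show ?thesis by (simp add: order_def)
qed

text \<open>Descent with four exits: a nonzero vector becomes an eigenvector of N, P, P C4 and
  finally G. A weight nontrivial on the centre, on P or at -1 gives 2 p^2, 8 or 2 respectively. If
  it is trivial there, the vector is fixed by the centre, by P or by P C2, and the next subgroup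
  commutes modulo that one; an eigenvector of G itself gives 1.\<close>

lemma degree_cases: "n \<in> {1, 2, 8, 2 * p ^ 2}"
proof -
  let ?P = "elts {q1} UNIV"
  have n: "n > 0" using irr by (simp add: irreducible_rep_def)
  have e: "unit_vec n 0 \<in> carrier_vec n" "unit_vec n 0 \<noteq> (0\<^sub>v n :: complex vec)"
    using n by auto
  have "\<exists>v \<mu>. v \<in> carrier_vec n \<and> v \<noteq> 0\<^sub>v n \<and> (\<forall>k\<in>{\<one>\<^bsub>G\<^esub>}. \<rho> k *\<^sub>v v = v) \<and>
      (\<forall>t\<in>elts {q1} {0}. \<rho> t *\<^sub>v v = \<mu> t \<cdot>\<^sub>v v)"
  proof (rule common_eigenvector_fixed[OF _ one_is_normal e])
    show "\<exists>k\<in>{\<one>\<^bsub>G\<^esub>}. s \<otimes>\<^bsub>G\<^esub> t = t \<otimes>\<^bsub>G\<^esub> s \<otimes>\<^bsub>G\<^esub> k" if "s \<in> elts {q1} {0}" "t \<in> elts {q1} {0}" for s t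
      using that by (elim elts_cases) (simp add: mult_el one_G add.commute)
  qed (use elts_sub_G rho_one e(1) in auto)
  then obtain w \<mu> where w: "w \<in> carrier_vec n" "w \<noteq> 0\<^sub>v n" "\<And>t. t \<in> elts {q1} {0} \<Longrightarrow> \<rho> t *\<^sub>v w = \<mu> t \<cdot>\<^sub>v w"
    by blast
  show ?thesis
  proof (cases "\<forall>c. \<mu> (el q1 0 0 0 0 c) = 1")
    case False
    thus ?thesis using degree_central_nontrivial[OF w] by blast
  next
    case True
    have "\<exists>v \<mu>. v \<in> carrier_vec n \<and> v \<noteq> 0\<^sub>v n \<and> (\<forall>k\<in>Zc. \<rho> k *\<^sub>v v = v) \<and> (\<forall>t\<in>?P. \<rho> t *\<^sub>v v = \<mu> t \<cdot>\<^sub>v v)"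
    proof (rule common_eigenvector_fixed[OF _ normal_Zc w(1,2)])
      show "\<rho> k *\<^sub>v w = w" if "k \<in> Zc" for k
        using that w True by (auto simp: Zc_def)
      fix s t assume "s \<in> ?P" "t \<in> ?P"
      then obtain u1 u2 v1 v2 z r1 r2 s1 s2 z'
        where "s = el q1 u1 u2 v1 v2 z" "t = el q1 r1 r2 s1 s2 z'" by (elim elts_cases) auto
      hence "s \<otimes>\<^bsub>G\<^esub> t = t \<otimes>\<^bsub>G\<^esub> s \<otimes>\<^bsub>G\<^esub> el q1 0 0 0 0 (u1 * s1 + u2 * s2 - (r1 * v1 + r2 * v2))"
        by (simp add: mult_el algebra_simps)
      thus "\<exists>k\<in>Zc. s \<otimes>\<^bsub>G\<^esub> t = t \<otimes>\<^bsub>G\<^esub> s \<otimes>\<^bsub>G\<^esub> k" by (rule bexI) simp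
    qed (rule elts_sub_G; simp)
    then obtain v \<nu> where v: "v \<in> carrier_vec n" "v \<noteq> 0\<^sub>v n" "\<And>k. k \<in> Zc \<Longrightarrow> \<rho> k *\<^sub>v v = v"
      "\<And>t. t \<in> ?P \<Longrightarrow> \<rho> t *\<^sub>v v = \<nu> t \<cdot>\<^sub>v v" by blast
    have \<nu>Z: "\<nu> (el q1 0 0 0 0 z) = 1" for z
      by (rule eigenvalue_unique[OF v(1,2)]) (simp flip: v(4) add: v(3))
    show ?thesis
    proof (cases "\<forall>y\<in>?P. \<nu> y = 1")
      case False
      thus ?thesis using degree_linear_nontrivial[OF v(1,2,4) \<nu>Z] by blast
    next
      case True
      have "\<exists>x \<mu>. x \<in> carrier_vec n \<and> x \<noteq> 0\<^sub>v n \<and> (\<forall>k\<in>?P. \<rho> k *\<^sub>v x = x) \<and> (\<forall>t\<in>elts C4 UNIV. \<rho> t *\<^sub>v x = \<mu> t \<cdot>\<^sub>v x)"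
      proof (rule common_eigenvector_fixed[OF _ _ v(1,2)])
        show C4G: "elts C4 UNIV \<subseteq> carrier G" by (rule elts_sub_G) auto
        show "\<rho> k *\<^sub>v v = v" if "k \<in> ?P" for k using v(4)[OF that] True that by simp
        fix s t assume s: "s \<in> elts C4 UNIV" and t: "t \<in> elts C4 UNIV"
        have st: "s \<in> carrier G" "t \<in> carrier G" using s t C4G by auto
        hence "qpart s \<in> C4" "qpart t \<in> C4" using s t mem_elts_UNIV C4_Q8 by auto
        hence "qm (qpart s) (qpart t) = qm (qpart t) (qpart s)" "qm (qpart t) (qpart s) \<in> Q8"
          using qm_C4_commute C4_Q8 qm_Q8 by blast+
        thus "\<exists>k\<in>?P. s \<otimes>\<^bsub>G\<^esub> t = t \<otimes>\<^bsub>G\<^esub> s \<otimes>\<^bsub>G\<^esub> k"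
          by (intro commute_modulo_elts st) (simp_all add: qm_qc)
      qed (simp add: normal_elts)
      then obtain x \<xi> where x: "x \<in> carrier_vec n" "x \<noteq> 0\<^sub>v n" "\<And>k. k \<in> ?P \<Longrightarrow> \<rho> k *\<^sub>v x = x"
        "\<And>t. t \<in> elts C4 UNIV \<Longrightarrow> \<rho> t *\<^sub>v x = \<xi> t \<cdot>\<^sub>v x" by blast
      have sub: "?P \<subseteq> elts C4 UNIV" by (auto elim!: elts_cases)
      have \<xi>P: "\<xi> y = 1" if "y \<in> ?P" for y
        by (rule eigenvalue_unique[OF x(1,2)]) (use x(3)[OF that] x(4)[OF subsetD[OF sub that]] in simp)
      show ?thesis
      proof (cases "\<xi> (el mq 0 0 0 0 0) = 1")
        case False
        thus ?thesis using degree_C4_nontrivial[OF x(1,2,4) \<xi>P] by blast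
      next
        case True
        have "\<exists>y \<mu>. y \<in> carrier_vec n \<and> y \<noteq> 0\<^sub>v n \<and> (\<forall>k\<in>elts C2 UNIV. \<rho> k *\<^sub>v y = y) \<and> (\<forall>t\<in>carrier G. \<rho> t *\<^sub>v y = \<mu> t \<cdot>\<^sub>v y)"
        proof (rule common_eigenvector_fixed[OF subset_refl _ x(1,2)])
          show "\<rho> k *\<^sub>v x = x" if "k \<in> elts C2 UNIV" for k
          proof -
            obtain q u1 u2 v1 v2 z where q: "q \<in> C2" and k: "k = el q u1 u2 v1 v2 z" using \<open>k \<in> elts C2 UNIV\<close> by (elim elts_cases)
            have qQ: "q \<in> Q8" and qC4: "q \<in> C4" using q C2_C4 C4_Q8 by auto
            have "q = q1 \<or> q = mq" using q by (auto simp: C2_def)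
            hence "\<xi> (el q 0 0 0 0 0) = 1" using True \<xi>P[of "el q1 0 0 0 0 0"] by auto
            hence "\<rho> (el q 0 0 0 0 0) *\<^sub>v x = x" using x(4)[of "el q 0 0 0 0 0"] qC4 by simp
            moreover have "k = el q 0 0 0 0 0 \<otimes>\<^bsub>G\<^esub> el q1 (chi q * u1) (chi q * u2) (act1 (qc q) v1 v2) (act2 (qc q) v1 v2) (chi q * z)"
              unfolding k by (rule el_factor[OF qQ])
            ultimately show ?thesis using x(1,3) qQ by (simp only: rho_mult carrier_G el_in_elts UNIV_I one_simps insertI1)
          qed
          fix s t assume st: "s \<in> carrier G" "t \<in> carrier G"
          show "\<exists>k\<in>elts C2 UNIV. s \<otimes>\<^bsub>G\<^esub> t = t \<otimes>\<^bsub>G\<^esub> s \<otimes>\<^bsub>G\<^esub> k"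
            by (intro commute_modulo_elts st commutator_Q8' qpart_Q8) (use Q8_subsets(1)[of C2] in auto)
        qed (simp add: normal_elts)
        then obtain y \<eta> where "y \<in> carrier_vec n" "y \<noteq> 0\<^sub>v n" "\<And>t. t \<in> carrier G \<Longrightarrow> \<rho> t *\<^sub>v y = \<eta> t \<cdot>\<^sub>v y" by blast
        thus ?thesis using degree_linear by blast
      qed
    qed
  qed
qed

end

lemma (in q8_heisenberg) char_degrees_G: "char_degrees G = {1, 2, 8, 2 * p ^ 2}"
proof
  show "char_degrees G \<subseteq> {1, 2, 8, 2 * p ^ 2}"
  proof
    fix n assume "n \<in> char_degrees G"
    then obtain \<rho> where "irreducible_rep G n \<rho>" by (auto simp: char_degrees_def)
    then interpret q8_irrep p a b n \<rho> by unfold_locales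
    show "n \<in> {1, 2, 8, 2 * p ^ 2}" by (rule degree_cases)
  qed
qed (use one_in_char_degrees two_in_char_degrees eight_in_char_degrees two_p2_in_char_degrees in auto)

text \<open>Pigeonhole: with p = 2h + 1, the h + 1 residues x^2 and the h + 1 residues -1 - y^2
  cannot be disjoint among p residues.\<close>

lemma minus_one_sum_two_squares:
  fixes p :: nat
  assumes p: "Factorial_Ring.prime p" and odd: "odd p"
  shows "\<exists>a b. int p dvd a\<^sup>2 + b\<^sup>2 + 1"
proof -
  obtain h where h: "p = 2 * h + 1" using odd by (elim oddE)
  let ?H = "{0..int h}"
  let ?f = "\<lambda>x::int. x\<^sup>2 mod int p" and ?g = "\<lambda>x::int. (- 1 - x\<^sup>2) mod int p"
  \<comment> \<open>On 0..h the sums and differences are smaller than p in absolute value, so p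
    divides one only if it is zero; both cases give x = y as x and y are nonnegative.\<close>
  have inj: "x = y" if xy: "x \<in> ?H" "y \<in> ?H" and d: "int p dvd x\<^sup>2 - y\<^sup>2" for x y
  proof -
    have "int p dvd (x - y) * (x + y)" using d by (simp add: power2_eq_square algebra_simps)
    hence "int p dvd x - y \<or> int p dvd x + y" using p by (simp add: prime_dvd_mult_iff)
    moreover have "\<bar>x - y\<bar> < int p" "\<bar>x + y\<bar> < int p" using xy h by auto
    ultimately have "x - y = 0 \<or> x + y = 0" by (metis dvd_imp_le_int not_le abs_of_nat)
    thus ?thesis using xy by auto
  qed
  have "inj_on ?f ?H" "inj_on ?g ?H"
    by (auto intro!: inj_onI inj simp: mod_eq_dvd_iff dvd_diff_commute)
  hence card: "card (?f ` ?H) = h + 1" "card (?g ` ?H) = h + 1"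
    by (simp_all add: card_image)
  have p0: "int p > 0" using h by simp
  have "?f ` ?H \<inter> ?g ` ?H \<noteq> {}"
  proof
    assume "?f ` ?H \<inter> ?g ` ?H = {}"
    hence "card (?f ` ?H \<union> ?g ` ?H) = 2 * h + 2" by (subst card_Un_disjoint) (simp_all add: card)
    moreover have "card (?f ` ?H \<union> ?g ` ?H) \<le> card {0..<int p}"
      by (intro card_mono) (use p0 in auto)
    ultimately show False using h by simp
  qed
  then obtain a b where "a\<^sup>2 mod int p = (- 1 - b\<^sup>2) mod int p" by blast
  hence "int p dvd a\<^sup>2 + b\<^sup>2 + 1" by (simp add: mod_eq_dvd_iff algebra_simps)
  thus ?thesis by blast
qed

theorem theorem3p7:
  fixes p :: nat
  assumes "Factorial_Ring.prime p" and "p mod 8 = 3"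
  shows "\<exists>G :: nat monoid. group G \<and> finite (carrier G) \<and> solvable G \<and>
           derived_length G = 4 \<and> fitting_height G = 2 \<and>
           char_degrees G = {1, 2, 8, 2 * p ^ 2}"
proof -
  have "odd p" "p > 2" using assms(2) by presburger+
  then obtain a b where "int p dvd a\<^sup>2 + b\<^sup>2 + 1" using minus_one_sum_two_squares assms(1) by blast
  then interpret q8_heisenberg p a b by unfold_locales (use assms(1) \<open>p > 2\<close> in auto)
  show ?thesis
    using group_G finite_G solvable_G derived_length_G fitting_height_G char_degrees_G by blast
qed

end
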